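(* Let $s_1,\dots,s_n$ be the semicircular system $s_j=\ell_j+\ell_j^*$ on the full Fock space $\mathcal{T}(\mathbb{C}^n)$. Identifying $\mathcal{T}(\mathbb{C}^n)$ and $L^2(W^*(s_1,\dots,s_n),\tau)$ we have $$(\mathcal{T}(\mathbb{C}^n))^n\ominus\overline{\delta^s\mathbb{C}\langle s_1,\dots,s_n\rangle}=\{((\ell_j^*-r_j^* )\xi)_{1\le j\le n}\mid \xi\in\mathcal{T}(\mathbb{C}^n)\} .$$ In particular $$\mathrm{Vect}\,\mathbb{C}\langle s_1,\dots,s_n\mid\tau\rangle=\sum_{k\ge0}\mathcal{X}_k ,$$ where $\mathcal{X}_k\subset(\mathcal{T}_k(\mathbb{C}^n))^n$, $\mathcal{X}_0=0$, and $\mathcal{X}_k$ for $k\ge1$ is spanned by the elements $$\big(\delta_{j,i_0}\,e_{i_1}\otimes\cdots\otimes e_{i_k}-\delta_{j,i_k}\,e_{i_0}\otimes\cdots\otimes e_{i_{k-1}}\big)_{1\le j\le n},\qquad (i_0,\dots,i_k)\in\{1,\dots,n\}^{k+1}$$ (here $\delta_{j,i}$ is the Kronecker symbol).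
   Context: $\mathcal{T}(\mathbb{C}^n)=\bigoplus_{k\ge0}(\mathbb{C}^n)^{\otimes k}$ (Hilbert space direct sum) is the full Fock space, $(\mathbb{C}^n)^{\otimes0}=\mathbb{C}1$ with $1$ the vacuum vector, $\mathcal{T}_k(\mathbb{C}^n)=(\mathbb{C}^n)^{\otimes k}$; $e_1,\dots,e_n$ is the standard orthonormal basis of $\mathbb{C}^n$; $\ell_j\xi=e_j\otimes\xi$ and $r_j\xi=\xi\otimes e_j$ are the left and right creation operators. $s_j=\ell_j+\ell_j^*$ ($1\le j\le n$) is a semicircular system with respect to the vacuum expectation $\tau=\langle\,\cdot\,1,1\rangle$, which is a faithful normal tracial state on the von Neumann algebra $W^*(s_1,\dots,s_n)$. $L^2(W^*(s_1,\dots,s_n),\tau)$ is identified with $\mathcal{T}(\mathbb{C}^n)$ via $x\mapsto x1$; in particular elements of $\mathbb{C}\langle s_1,\dots,s_n\rangle$ (the unital algebra generated by the $s_j$, which are algebraically free) are viewed as vectors of $\mathcal{T}(\mathbb{C}^n)$. $\delta^s=(\delta_1^s,\dots,\delta_n^s):\mathbb{C}\langle s_1,\dots,s_n\rangle\to(\mathbb{C}\langle s_1,\dots,s_n\rangle)^n$ is the cyclic gradient: $\delta_j^s1=0$, $\delta^s_js_{i_1}\cdots s_{i_p}=\sum_{k:\,i_k=j}s_{i_{k+1}}\cdots s_{i_p}s_{i_1}\cdots s_{i_{k-1}}$. The bar denotes closure in $(\mathcal{T}(\mathbb{C}^n))^n$, and $\ominus$ denotes orthogonal complement. $\mathrm{Vect}\,\mathbb{C}\langle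 s_1,\dots,s_n\mid\tau\rangle$ is the set of $n$-tuples $P=(P_1,\dots,P_n)$ of elements of $\mathbb{C}\langle s_1,\dots,s_n\rangle$ with $\sum_{1\le j\le n}\tau(P_j\,\delta_j^sR)=0$ for all $R\in\mathbb{C}\langle s_1,\dots,s_n\rangle$. The sum $\sum_{k\ge0}\mathcal{X}_k$ is the algebraic sum (finite sums).
   Formalization: In the first equality the right-hand side is replaced by its closure: for n ≥ 2 the set of tuples ((ℓ_j^* − r_j^* )ξ)_j is not closed (on words of length p the map is 1 − cyclic rotation, with singular values tending to 0), whereas an orthogonal complement is closed. *)

theory Defs
  imports "HOL-Analysis.Analysis"
begin

section \<open>The full Fock space\<close>

text \<open>
  The index type \<open>'n\<close> (finite in the main statement) plays the role of \<open>{1, \<dots>, n}\<close>.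
  The words of length \<open>k\<close> over \<open>'n\<close> index the orthonormal basis
  \<open>e\<^sub>i\<^sub>_\<^sub>1 \<otimes> \<dots> \<otimes> e\<^sub>i\<^sub>_\<^sub>k\<close> of \<open>(\<complex>\<^sup>n)\<^sup>\<otimes>\<^sup>k\<close>, so the Hilbert space direct sum of the tensor powers
  is the space of square-summable coefficient families on all words; the empty word is the
  vacuum.
\<close>

definition square_summable :: "('a \<Rightarrow> complex) \<Rightarrow> bool" where
  "square_summable f \<longleftrightarrow> (\<lambda>w. (cmod (f w))\<^sup>2) summable_on UNIV"

typedef 'n fock = "{f :: 'n list \<Rightarrow> complex. square_summable f}"
  morphisms coeff Abs_fock
  by (rule exI[of _ "\<lambda>_. 0"]) (simp add: square_summable_def)

setup_lifting type_definition_fock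

lemma square_summable_coeff [simp]: "square_summable (coeff \<xi>)"
  using coeff[of \<xi>] by simp

lemma fock_eqI: "(\<And>w. coeff \<xi> w = coeff \<eta> w) \<Longrightarrow> \<xi> = \<eta>"
  by (simp add: coeff_inject[symmetric] fun_eq_iff)

lemma square_summable_mult:
  assumes "square_summable f" "square_summable g"
  shows "(\<lambda>w. f w * cnj (g w)) summable_on UNIV"
proof -
  have sum: "(\<lambda>w. (cmod (f w))\<^sup>2 + (cmod (g w))\<^sup>2) summable_on UNIV"
    using assms unfolding square_summable_def by (rule summable_on_add)
  have le: "cmod (f w * cnj (g w)) \<le> (cmod (f w))\<^sup>2 + (cmod (g w))\<^sup>2" for w
  proof -
    have "0 \<le> (cmod (f w) - cmod (g w))\<^sup>2" by simp
    moreover have "0 \<le> (cmod (f w))\<^sup>2 + (cmod (g w))\<^sup>2" by simp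
    ultimately show ?thesis
      unfolding power2_diff norm_mult complex_mod_cnj by linarith
  qed
  have "(\<lambda>w. norm (f w * cnj (g w))) summable_on UNIV"
    by (rule summable_on_comparison_test[OF sum le]) simp
  then show ?thesis by (rule abs_summable_summable)
qed

lemma square_summable_scale: "square_summable f \<Longrightarrow> square_summable (\<lambda>w. c * f w)"
  unfolding square_summable_def norm_mult power_mult_distrib by (rule summable_on_cmult_right)

lemma square_summable_add:
  assumes "square_summable f" "square_summable g"
  shows "square_summable (\<lambda>w. f w + g w)"
proof -
  have "(\<lambda>w. 2 * ((cmod (f w))\<^sup>2 + (cmod (g w))\<^sup>2)) summable_on UNIV"
    using assms unfolding square_summable_def by (intro summable_on_cmult_right summable_on_add)
  moreover have "(cmod (f w + g w))\<^sup>2 \<le> 2 * ((cmod (f w))\<^sup>2 + (cmod (g w))\<^sup>2)" for w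
  proof -
    have "(cmod (f w + g w))\<^sup>2 \<le> (cmod (f w) + cmod (g w))\<^sup>2"
      by (intro power_mono norm_triangle_ineq) simp
    moreover have "0 \<le> (cmod (f w) - cmod (g w))\<^sup>2" by simp
    ultimately show ?thesis unfolding power2_diff power2_sum by (simp add: algebra_simps)
  qed
  ultimately show ?thesis
    unfolding square_summable_def by (rule summable_on_comparison_test) auto
qed

lemma square_summable_comp_inj:
  assumes "inj h" "square_summable f"
  shows "square_summable (\<lambda>w. f (h w))"
proof -
  have "(\<lambda>w. (cmod (f w))\<^sup>2) summable_on range h"
    using assms(2) unfolding square_summable_def by (rule summable_on_subset_banach) simp
  then show ?thesis
    unfolding square_summable_def summable_on_reindex[OF assms(1)] by (simp add: o_def)
qed

lemma square_summable_extend_inj: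
  assumes "inj h" "square_summable f" "\<And>w. g (h w) = f w" "\<And>v. v \<notin> range h \<Longrightarrow> g v = 0"
  shows "square_summable g"
proof -
  have "(\<lambda>w. (cmod (g w))\<^sup>2) summable_on range h"
    using assms(2) unfolding square_summable_def summable_on_reindex[OF assms(1)]
    by (simp add: o_def assms(3))
  then show ?thesis
    unfolding square_summable_def
    by (rule iffD1[OF summable_on_cong_neutral, rotated -1]) (auto simp: assms(4))
qed

instantiation fock :: (type) ab_group_add
begin

lift_definition zero_fock :: "'a fock" is "\<lambda>_. 0"
  by (simp add: square_summable_def)

lift_definition plus_fock :: "'a fock \<Rightarrow> 'a fock \<Rightarrow> 'a fock" is "\<lambda>f g w. f w + g w"
  by (rule square_summable_add)

lift_definition uminus_fock :: "'a fock \<Rightarrow> 'a fock" is "\<lambda>f w. - f w"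
  by (simp add: square_summable_def)

lift_definition minus_fock :: "'a fock \<Rightarrow> 'a fock \<Rightarrow> 'a fock" is "\<lambda>f g w. f w - g w"
  using square_summable_add[OF _ square_summable_scale[of _ "-1"]] by fastforce

instance
  by standard (transfer; simp add: fun_eq_iff)+

end

lift_definition scaleC :: "complex \<Rightarrow> 'n fock \<Rightarrow> 'n fock"  (infixr \<open>*\<^sub>C\<close> 75)
  is "\<lambda>c f w. c * f w"
  by (rule square_summable_scale)

lemma coeff_simps [simp]:
  "coeff 0 w = 0" "coeff (\<xi> + \<eta>) w = coeff \<xi> w + coeff \<eta> w" "coeff (- \<xi>) w = - coeff \<xi> w"
  "coeff (\<xi> - \<eta>) w = coeff \<xi> w - coeff \<eta> w" "coeff (c *\<^sub>C \<xi>) w = c * coeff \<xi> w"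
  by (transfer; simp)+

lemma coeff_sum [simp]: "coeff (sum f A) w = (\<Sum>x\<in>A. coeff (f x) w)"
  by (induction A rule: infinite_finite_induct) auto

text \<open>Linear in the first argument, as in \<open>\<tau> = \<langle>\<cdot> 1, 1\<rangle>\<close>.\<close>

definition cinner :: "'n fock \<Rightarrow> 'n fock \<Rightarrow> complex" where
  "cinner \<xi> \<eta> = (\<Sum>\<^sub>\<infinity>w. coeff \<xi> w * cnj (coeff \<eta> w))"

lemma summable_cinner: "(\<lambda>w. coeff \<xi> w * cnj (coeff \<eta> w)) summable_on UNIV"
  by (rule square_summable_mult) simp_all

lemma cinner_add_left: "cinner (\<xi> + \<eta>) \<zeta> = cinner \<xi> \<zeta> + cinner \<eta> \<zeta>"
  unfolding cinner_def by (simp add: distrib_right infsum_add summable_cinner)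

lemma cinner_scaleC_left: "cinner (c *\<^sub>C \<xi>) \<eta> = c * cinner \<xi> \<eta>"
  unfolding cinner_def by (simp add: mult.assoc infsum_cmult_right')

lemma cinner_commute: "cinner \<xi> \<eta> = cnj (cinner \<eta> \<xi>)"
  unfolding cinner_def by (simp flip: infsum_cnj add: mult.commute)

lemma cinner_self: "cinner \<xi> \<xi> = of_real (\<Sum>\<^sub>\<infinity>w. (cmod (coeff \<xi> w))\<^sup>2)"
proof -
  have "((\<lambda>w. (cmod (coeff \<xi> w))\<^sup>2) has_sum (\<Sum>\<^sub>\<infinity>w. (cmod (coeff \<xi> w))\<^sup>2)) UNIV"
    using square_summable_coeff[of \<xi>] unfolding square_summable_def by (rule has_sum_infsum)
  then have "((\<lambda>w. complex_of_real ((cmod (coeff \<xi> w))\<^sup>2)) has_sum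
      of_real (\<Sum>\<^sub>\<infinity>w. (cmod (coeff \<xi> w))\<^sup>2)) UNIV"
    by (rule has_sum_of_real)
  then show ?thesis
    unfolding cinner_def complex_norm_square[symmetric] by (rule infsumI)
qed

text \<open>
  The underlying real Hilbert space structure; it provides the norm \<open>sqrt (cinner \<xi> \<xi>)\<close>,
  the topology, and the \<open>\<ell>\<^sup>2\<close>-norm on tuples \<open>'n fock ^ 'n\<close> through the library instances.
\<close>

instantiation fock :: (type) real_inner
begin

definition scaleR_fock :: "real \<Rightarrow> 'a fock \<Rightarrow> 'a fock" where
  "scaleR_fock r \<xi> = of_real r *\<^sub>C \<xi>"

definition inner_fock :: "'a fock \<Rightarrow> 'a fock \<Rightarrow> real" where
  "inner_fock \<xi> \<eta> = Re (cinner \<xi> \<eta>)"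

definition norm_fock :: "'a fock \<Rightarrow> real" where
  "norm_fock \<xi> = sqrt (inner \<xi> \<xi>)"

definition sgn_fock :: "'a fock \<Rightarrow> 'a fock" where
  "sgn_fock \<xi> = inverse (norm \<xi>) *\<^sub>R \<xi>"

definition dist_fock :: "'a fock \<Rightarrow> 'a fock \<Rightarrow> real" where
  "dist_fock \<xi> \<eta> = norm (\<xi> - \<eta>)"

definition uniformity_fock :: "('a fock \<times> 'a fock) filter" where
  "uniformity_fock = (INF e\<in>{0 <..}. principal {(\<xi>, \<eta>). dist \<xi> \<eta> < e})"

definition open_fock :: "'a fock set \<Rightarrow> bool" where
  "open_fock U \<longleftrightarrow> (\<forall>\<xi>\<in>U. eventually (\<lambda>(\<xi>', \<eta>). \<xi>' = \<xi> \<longrightarrow> \<eta> \<in> U) uniformity)"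

instance
proof
  fix \<xi> \<eta> \<zeta> :: "'a fock" and r s :: real
  show "r *\<^sub>R (\<xi> + \<eta>) = r *\<^sub>R \<xi> + r *\<^sub>R \<eta>" "(r + s) *\<^sub>R \<xi> = r *\<^sub>R \<xi> + s *\<^sub>R \<xi>"
    "r *\<^sub>R s *\<^sub>R \<xi> = (r * s) *\<^sub>R \<xi>" "1 *\<^sub>R \<xi> = \<xi>"
    by (auto intro!: fock_eqI simp: scaleR_fock_def algebra_simps)
  show "inner \<xi> \<eta> = inner \<eta> \<xi>"
    unfolding inner_fock_def by (subst cinner_commute) simp
  show "inner (\<xi> + \<eta>) \<zeta> = inner \<xi> \<zeta> + inner \<eta> \<zeta>"
    by (simp add: inner_fock_def cinner_add_left)
  show "inner (r *\<^sub>R \<xi>) \<eta> = r * inner \<xi> \<eta>"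
    by (simp add: inner_fock_def scaleR_fock_def cinner_scaleC_left)
  show "0 \<le> inner \<xi> \<xi>"
    by (simp add: inner_fock_def cinner_self infsum_nonneg)
  show "inner \<xi> \<xi> = 0 \<longleftrightarrow> \<xi> = 0"
  proof
    assume "inner \<xi> \<xi> = 0"
    then have *: "(\<Sum>\<^sub>\<infinity>w. (cmod (coeff \<xi> w))\<^sup>2) \<le> 0"
      by (simp add: inner_fock_def cinner_self)
    have "(cmod (coeff \<xi> w))\<^sup>2 = 0" for w
      by (rule nonneg_infsum_le_0D[OF *])
        (use square_summable_coeff[of \<xi>] in \<open>auto simp: square_summable_def\<close>)
    then show "\<xi> = 0" by (auto intro!: fock_eqI)
  qed (simp add: inner_fock_def cinner_def)
qed (simp_all add: norm_fock_def sgn_fock_def dist_fock_def uniformity_fock_def open_fock_def)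

end

text \<open>\<open>basis [i\<^sub>1, \<dots>, i\<^sub>k]\<close> is \<open>e\<^sub>i\<^sub>_\<^sub>1 \<otimes> \<dots> \<otimes> e\<^sub>i\<^sub>_\<^sub>k\<close>.\<close>

lift_definition basis :: "'n list \<Rightarrow> 'n fock" is "\<lambda>u w. if w = u then 1 else 0"
proof -
  fix u :: "'n list"
  have "(\<lambda>w. (cmod (if w = u then 1 else 0))\<^sup>2) summable_on {u}" by simp
  then show "square_summable (\<lambda>w. if w = u then 1 else 0)"
    unfolding square_summable_def
    by (rule iffD1[OF summable_on_cong_neutral, rotated -1]) auto
qed

definition vacuum :: "'n fock" where
  "vacuum = basis []"

definition homogeneous :: "nat \<Rightarrow> 'n fock set" where
  "homogeneous k = {\<xi>. \<forall>w. length w \<noteq> k \<longrightarrow> coeff \<xi> w = 0}"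

section \<open>Creation operators and adjoints\<close>

text \<open>\<open>lcreate j \<xi> = e\<^sub>j \<otimes> \<xi>\<close> and \<open>rcreate j \<xi> = \<xi> \<otimes> e\<^sub>j\<close>, in coefficients.\<close>

lift_definition lcreate :: "'n \<Rightarrow> 'n fock \<Rightarrow> 'n fock"
  is "\<lambda>j f w. case w of [] \<Rightarrow> 0 | i # v \<Rightarrow> if i = j then f v else 0"
  by (rule square_summable_extend_inj[where h = "(#) _"]) (auto split: list.splits)

lift_definition rcreate :: "'n \<Rightarrow> 'n fock \<Rightarrow> 'n fock"
  is "\<lambda>j f w. if w \<noteq> [] \<and> last w = j then f (butlast w) else 0"
  subgoal for j f
    by (rule square_summable_extend_inj[where h = "\<lambda>w. w @ [j]" and f = f])
      (auto simp: inj_def image_iff, metis append_butlast_last_id)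
  done

definition cadjoint :: "('n fock \<Rightarrow> 'n fock) \<Rightarrow> 'n fock \<Rightarrow> 'n fock" where
  "cadjoint A = (THE B. \<forall>\<xi> \<eta>. cinner (A \<xi>) \<eta> = cinner \<xi> (B \<eta>))"

lemma coeff_basis: "coeff (basis u) w = (if w = u then 1 else 0)"
  by transfer simp

lemma coeff_lcreate:
  "coeff (lcreate j \<xi>) [] = 0" "coeff (lcreate j \<xi>) (i # w) = (if i = j then coeff \<xi> w else 0)"
  by (transfer; simp)+

lemma coeff_rcreate:
  "coeff (rcreate j \<xi>) [] = 0" "coeff (rcreate j \<xi>) (w @ [i]) = (if i = j then coeff \<xi> w else 0)"
  by (transfer; simp)+

lemma lcreate_basis: "lcreate j (basis w) = basis (j # w)"
proof (rule fock_eqI)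
  fix v show "coeff (lcreate j (basis w)) v = coeff (basis (j # w)) v"
    by (cases v) (auto simp: coeff_basis coeff_lcreate)
qed

lemma rcreate_basis: "rcreate j (basis w) = basis (w @ [j])"
proof (rule fock_eqI)
  fix v show "coeff (rcreate j (basis w)) v = coeff (basis (w @ [j])) v"
    by (cases v rule: rev_cases) (auto simp: coeff_basis coeff_rcreate)
qed

lemma cinner_basis_left: "cinner (basis w) \<xi> = cnj (coeff \<xi> w)"
proof -
  have "cinner (basis w) \<xi> = (\<Sum>\<^sub>\<infinity>v\<in>{w}. coeff (basis w) v * cnj (coeff \<xi> v))"
    unfolding cinner_def by (rule infsum_cong_neutral) (auto simp: coeff_basis)
  then show ?thesis by (simp add: coeff_basis)
qed

lemma cadjointI:
  assumes "\<And>\<xi> \<eta>. cinner (A \<xi>) \<eta> = cinner \<xi> (B \<eta>)"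
  shows "cadjoint A = B"
  unfolding cadjoint_def
proof (rule the_equality)
  fix B' assume B': "\<forall>\<xi> \<eta>. cinner (A \<xi>) \<eta> = cinner \<xi> (B' \<eta>)"
  have "coeff (B' \<eta>) w = coeff (B \<eta>) w" for \<eta> w
    using B'[rule_format, of "basis w" \<eta>] assms[of "basis w" \<eta>]
    by (simp add: cinner_basis_left)
  then show "B' = B" by (intro ext fock_eqI)
qed (use assms in blast)

lift_definition lannihilate :: "'n \<Rightarrow> 'n fock \<Rightarrow> 'n fock" is "\<lambda>j f w. f (j # w)"
  by (rule square_summable_comp_inj) auto

lift_definition rannihilate :: "'n \<Rightarrow> 'n fock \<Rightarrow> 'n fock" is "\<lambda>j f w. f (w @ [j])"
  by (rule square_summable_comp_inj) (auto simp: inj_def)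

lemma coeff_annihilate [simp]:
  "coeff (lannihilate j \<xi>) w = coeff \<xi> (j # w)" "coeff (rannihilate j \<xi>) w = coeff \<xi> (w @ [j])"
  by (transfer; simp)+

lemma cadjoint_lcreate: "cadjoint (lcreate j) = lannihilate j"
proof (rule cadjointI)
  fix \<xi> \<eta> :: "'a fock"
  have "cinner (lcreate j \<xi>) \<eta> =
      (\<Sum>\<^sub>\<infinity>w\<in>range ((#) j). coeff (lcreate j \<xi>) w * cnj (coeff \<eta> w))"
    unfolding cinner_def
  proof (rule infsum_cong_neutral)
    fix w assume "w \<in> UNIV - range ((#) j)"
    then show "coeff (lcreate j \<xi>) w * cnj (coeff \<eta> w) = 0"
      by (cases w) (auto simp: coeff_lcreate)
  qed auto
  also have "\<dots> = cinner \<xi> (lannihilate j \<eta>)"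
    unfolding cinner_def by (subst infsum_reindex) (auto simp: o_def coeff_lcreate)
  finally show "cinner (lcreate j \<xi>) \<eta> = cinner \<xi> (lannihilate j \<eta>)" .
qed

lemma cadjoint_rcreate: "cadjoint (rcreate j) = rannihilate j"
proof (rule cadjointI)
  fix \<xi> \<eta> :: "'a fock"
  have "cinner (rcreate j \<xi>) \<eta> =
      (\<Sum>\<^sub>\<infinity>w\<in>range (\<lambda>w. w @ [j]). coeff (rcreate j \<xi>) w * cnj (coeff \<eta> w))"
    unfolding cinner_def
  proof (rule infsum_cong_neutral)
    fix w assume "w \<in> UNIV - range (\<lambda>w. w @ [j])"
    then show "coeff (rcreate j \<xi>) w * cnj (coeff \<eta> w) = 0"
      by (cases w rule: rev_cases) (auto simp: coeff_rcreate)
  qed auto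
  also have "\<dots> = cinner \<xi> (rannihilate j \<eta>)"
    unfolding cinner_def by (subst infsum_reindex) (auto simp: o_def coeff_rcreate inj_def)
  finally show "cinner (rcreate j \<xi>) \<eta> = cinner \<xi> (rannihilate j \<eta>)" .
qed

section \<open>The semicircular system and its polynomial algebra\<close>

definition semicircular :: "'n \<Rightarrow> 'n fock \<Rightarrow> 'n fock" where
  "semicircular j \<xi> = lcreate j \<xi> + cadjoint (lcreate j) \<xi>"

definition vac_state :: "('n fock \<Rightarrow> 'n fock) \<Rightarrow> complex" where
  "vac_state a = cinner (a vacuum) vacuum"

inductive_set semicircular_algebra :: "('n fock \<Rightarrow> 'n fock) set" where
  one: "id \<in> semicircular_algebra"
| gen: "semicircular j \<in> semicircular_algebra"
| add: "a \<in> semicircular_algebra \<Longrightarrow> b \<in> semicircular_algebra \<Longrightarrow>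
    (\<lambda>\<xi>. a \<xi> + b \<xi>) \<in> semicircular_algebra"
| scale: "a \<in> semicircular_algebra \<Longrightarrow> (\<lambda>\<xi>. c *\<^sub>C a \<xi>) \<in> semicircular_algebra"
| mult: "a \<in> semicircular_algebra \<Longrightarrow> b \<in> semicircular_algebra \<Longrightarrow>
    a \<circ> b \<in> semicircular_algebra"

definition monomial :: "'n list \<Rightarrow> 'n fock \<Rightarrow> 'n fock" where
  "monomial w = foldr (\<lambda>j a. semicircular j \<circ> a) w id"

text \<open>
  Since the \<open>semicircular j\<close> are algebraically free, every element of the algebra has a unique
  expansion in monomials (\<open>semicircular_algebra_expansion\<close> below).  Its coefficients are used to
  extend the cyclic gradient linearly from monomials.
\<close>

definition is_expansion :: "('n fock \<Rightarrow> 'n fock) \<Rightarrow> ('n list \<Rightarrow> complex) \<Rightarrow> bool" where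
  "is_expansion a c \<longleftrightarrow>
     finite {w. c w \<noteq> 0} \<and> a = (\<lambda>\<xi>. \<Sum>w | c w \<noteq> 0. c w *\<^sub>C monomial w \<xi>)"

definition mon_coeff :: "('n fock \<Rightarrow> 'n fock) \<Rightarrow> 'n list \<Rightarrow> complex" where
  "mon_coeff a = (THE c. is_expansion a c)"

text \<open>
  \<open>\<delta>\<^sub>j s\<^sub>i\<^sub>_\<^sub>1 \<cdots> s\<^sub>i\<^sub>_\<^sub>p = \<Sum>\<^bsub>k: i_k = j\<^esub> s\<^sub>i\<^sub>_\<^sub>k\<^sub>+\<^sub>1 \<cdots> s\<^sub>i\<^sub>_\<^sub>p s\<^sub>i\<^sub>_\<^sub>1 \<cdots> s\<^sub>i\<^sub>_\<^sub>k\<^sub>-\<^sub>1\<close>, with positions counted from \<open>0\<close>.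
\<close>

definition cyclic_derivative_monomial :: "'n \<Rightarrow> 'n list \<Rightarrow> 'n fock \<Rightarrow> 'n fock" where
  "cyclic_derivative_monomial j w \<xi> =
     (\<Sum>k | k < length w \<and> w ! k = j. monomial (drop (Suc k) w @ take k w) \<xi>)"

definition cyclic_derivative :: "'n \<Rightarrow> ('n fock \<Rightarrow> 'n fock) \<Rightarrow> 'n fock \<Rightarrow> 'n fock" where
  "cyclic_derivative j a \<xi> =
     (\<Sum>w | mon_coeff a w \<noteq> 0. mon_coeff a w *\<^sub>C cyclic_derivative_monomial j w \<xi>)"

lemma monomial_Nil [simp]: "monomial [] = id"
  and monomial_Cons [simp]: "monomial (j # w) = semicircular j \<circ> monomial w"
  by (simp_all add: monomial_def)

lemma coeff_semicircular:
  "coeff (semicircular j \<xi>) w =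
     (case w of [] \<Rightarrow> 0 | i # v \<Rightarrow> if i = j then coeff \<xi> v else 0) + coeff \<xi> (j # w)"
  by (cases w) (simp_all add: semicircular_def cadjoint_lcreate coeff_lcreate)

lemma semicircular_add: "semicircular j (\<xi> + \<eta>) = semicircular j \<xi> + semicircular j \<eta>"
  by (rule fock_eqI) (auto simp: coeff_semicircular split: list.splits)

lemma semicircular_scaleC: "semicircular j (c *\<^sub>C \<xi>) = c *\<^sub>C semicircular j \<xi>"
  by (rule fock_eqI) (auto simp: coeff_semicircular algebra_simps split: list.splits)

lemma semicircular_0: "semicircular j 0 = 0"
  by (rule fock_eqI) (auto simp: coeff_semicircular split: list.splits)

lemma semicircular_sum: "semicircular j (sum f A) = (\<Sum>x\<in>A. semicircular j (f x))"
  by (induction A rule: infinite_finite_induct) (auto simp: semicircular_add semicircular_0)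

lemma coeff_monomial_vacuum:
  "length w \<le> length v \<Longrightarrow> coeff (monomial w vacuum) v = (if v = w then 1 else 0)"
proof (induction w arbitrary: v)
  case Nil
  then show ?case by (simp add: vacuum_def coeff_basis)
next
  case (Cons j w)
  then show ?case by (cases v) (auto simp: coeff_semicircular)
qed

lemma expansion_vacuum_zero:
  assumes fin: "finite {w. c w \<noteq> 0}"
    and zero: "(\<Sum>w | c w \<noteq> 0. c w *\<^sub>C monomial w vacuum) = 0"
  shows "c w = 0"
proof (rule ccontr)
  assume "c w \<noteq> 0"
  define m where "m = Max (length ` {w. c w \<noteq> 0})"
  have "m \<in> length ` {w. c w \<noteq> 0}"
    unfolding m_def using fin \<open>c w \<noteq> 0\<close> by (intro Max_in) auto
  then obtain v where v: "c v \<noteq> 0" "length v = m" by auto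
  have max: "length u \<le> length v" if "c u \<noteq> 0" for u
    unfolding v m_def using fin that by (intro Max_ge) auto
  have "0 = coeff (\<Sum>w | c w \<noteq> 0. c w *\<^sub>C monomial w vacuum) v"
    using zero by simp
  also have "\<dots> = (\<Sum>w | c w \<noteq> 0. c w * coeff (monomial w vacuum) v)"
    by simp
  also have "\<dots> = (\<Sum>w | c w \<noteq> 0. if w = v then c v else 0)"
    by (rule sum.cong) (auto simp: coeff_monomial_vacuum max)
  also have "\<dots> = c v"
    using fin v by simp
  finally show False using v by simp
qed

lemma expansion_superset:
  assumes "finite A" "{w. c w \<noteq> 0} \<subseteq> A"
  shows "(\<Sum>w | c w \<noteq> 0. c w *\<^sub>C f w) = (\<Sum>w\<in>A. c w *\<^sub>C f w)"
  using assms by (intro sum.mono_neutral_left) (auto intro: fock_eqI)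

lemma scaleC_one: "1 *\<^sub>C \<xi> = \<xi>"
  by (rule fock_eqI) simp

lemma scaleC_add_left: "(a + b) *\<^sub>C \<xi> = a *\<^sub>C \<xi> + b *\<^sub>C \<xi>"
  by (rule fock_eqI) (simp add: algebra_simps)

lemma scaleC_diff_left: "(a - b) *\<^sub>C \<xi> = a *\<^sub>C \<xi> - b *\<^sub>C \<xi>"
  by (rule fock_eqI) (simp add: algebra_simps)

lemma expansion_unique_vacuum:
  assumes "is_expansion a c" "is_expansion b d" "a vacuum = b vacuum"
  shows "c = d"
proof
  fix w
  define A where "A = {w. c w \<noteq> 0} \<union> {w. d w \<noteq> 0}"
  have A: "finite A" "{w. c w \<noteq> 0} \<subseteq> A" "{w. d w \<noteq> 0} \<subseteq> A" "{w. c w - d w \<noteq> 0} \<subseteq> A"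
    using assms(1,2) by (auto simp: A_def is_expansion_def)
  have "(\<Sum>w\<in>A. c w *\<^sub>C monomial w vacuum) = (\<Sum>w\<in>A. d w *\<^sub>C monomial w vacuum)"
    using assms A by (simp add: is_expansion_def expansion_superset)
  then have "(\<Sum>w\<in>A. (c w - d w) *\<^sub>C monomial w vacuum) = 0"
    by (simp add: scaleC_diff_left sum_subtractf)
  then have "(\<Sum>w | c w - d w \<noteq> 0. (c w - d w) *\<^sub>C monomial w vacuum) = 0"
    using expansion_superset[of A "\<lambda>w. c w - d w" "\<lambda>w. monomial w vacuum"] A by simp
  from expansion_vacuum_zero[OF finite_subset[OF A(4,1)] this]
  show "c w = d w" by simp
qed

lemma mon_coeff_eqI: "is_expansion a c \<Longrightarrow> mon_coeff a = c"
  unfolding mon_coeff_def by (rule the_equality) (auto intro: expansion_unique_vacuum)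

lemma is_expansion_add:
  assumes "is_expansion a c" "is_expansion b d"
  shows "is_expansion (\<lambda>\<xi>. a \<xi> + b \<xi>) (\<lambda>w. c w + d w)"
proof -
  define A where "A = {w. c w \<noteq> 0} \<union> {w. d w \<noteq> 0}"
  have A: "finite A" "{w. c w \<noteq> 0} \<subseteq> A" "{w. d w \<noteq> 0} \<subseteq> A" "{w. c w + d w \<noteq> 0} \<subseteq> A"
    using assms by (auto simp: A_def is_expansion_def)
  have "a \<xi> + b \<xi> = (\<Sum>w | c w + d w \<noteq> 0. (c w + d w) *\<^sub>C monomial w \<xi>)" for \<xi>
  proof -
    have "a \<xi> = (\<Sum>w\<in>A. c w *\<^sub>C monomial w \<xi>)" "b \<xi> = (\<Sum>w\<in>A. d w *\<^sub>C monomial w \<xi>)"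
      using assms by (simp_all only: is_expansion_def expansion_superset[OF A(1,2)]
          expansion_superset[OF A(1,3)])
    then have "a \<xi> + b \<xi> = (\<Sum>w\<in>A. (c w + d w) *\<^sub>C monomial w \<xi>)"
      by (simp only: scaleC_add_left sum.distrib)
    also have "\<dots> = (\<Sum>w | c w + d w \<noteq> 0. (c w + d w) *\<^sub>C monomial w \<xi>)"
      by (rule expansion_superset[OF A(1,4), symmetric])
    finally show ?thesis .
  qed
  with finite_subset[OF A(4,1)] show ?thesis
    unfolding is_expansion_def by blast
qed

lemma is_expansion_scale:
  assumes "is_expansion a c"
  shows "is_expansion (\<lambda>\<xi>. x *\<^sub>C a \<xi>) (\<lambda>w. x * c w)"
proof -
  have A: "finite {w. c w \<noteq> 0}" "{w. x * c w \<noteq> 0} \<subseteq> {w. c w \<noteq> 0}"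
    using assms by (auto simp: is_expansion_def)
  have "x *\<^sub>C (\<Sum>w | c w \<noteq> 0. c w *\<^sub>C f w) = (\<Sum>w | c w \<noteq> 0. (x * c w) *\<^sub>C f w)"
    for f :: "'a list \<Rightarrow> 'a fock"
    by (rule fock_eqI) (simp add: sum_distrib_left mult.assoc)
  then have "x *\<^sub>C a \<xi> = (\<Sum>w | c w \<noteq> 0. (x * c w) *\<^sub>C monomial w \<xi>)" for \<xi>
    using assms by (simp add: is_expansion_def)
  also have "\<dots> \<xi> = (\<Sum>w | x * c w \<noteq> 0. (x * c w) *\<^sub>C monomial w \<xi>)" for \<xi>
    by (rule expansion_superset[OF A, symmetric])
  finally show ?thesis
    using finite_subset[OF A(2,1)] unfolding is_expansion_def by blast
qed

lemma is_expansion_monomial: "is_expansion (monomial w) (\<lambda>v. if v = w then 1 else 0)"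
proof -
  have "{v. (if v = w then 1 else 0 :: complex) \<noteq> 0} = {w}" by auto
  then show ?thesis
    by (simp add: is_expansion_def fun_eq_iff scaleC_one)
qed

lemma expansion_sum:
  assumes "finite A" "\<And>x. x \<in> A \<Longrightarrow> \<exists>c. is_expansion (a x) c"
  shows "\<exists>c. is_expansion (\<lambda>\<xi>. \<Sum>x\<in>A. a x \<xi>) c"
  using assms
proof (induction A rule: finite_induct)
  case empty
  show ?case by (rule exI[of _ "\<lambda>_. 0"]) (simp add: is_expansion_def)
next
  case (insert x A)
  then obtain c d where "is_expansion (a x) c" "is_expansion (\<lambda>\<xi>. \<Sum>x\<in>A. a x \<xi>) d"
    by blast
  from is_expansion_add[OF this] insert(1,2) show ?case by auto
qed

lemma expansion_semicircular_comp:
  assumes "is_expansion b d"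
  shows "\<exists>c. is_expansion (semicircular j \<circ> b) c"
proof -
  have "semicircular j \<circ> b = (\<lambda>\<xi>. \<Sum>w | d w \<noteq> 0. d w *\<^sub>C monomial (j # w) \<xi>)"
    using assms by (simp add: is_expansion_def fun_eq_iff semicircular_sum semicircular_scaleC)
  moreover have "\<exists>c. is_expansion (\<lambda>\<xi>. \<Sum>w | d w \<noteq> 0. d w *\<^sub>C monomial (j # w) \<xi>) c"
  proof (rule expansion_sum)
    show "finite {w. d w \<noteq> 0}" using assms by (simp add: is_expansion_def)
  qed (rule exI, rule is_expansion_scale, rule is_expansion_monomial)
  ultimately show ?thesis by simp
qed

lemma expansion_monomial_comp:
  assumes "is_expansion b d"
  shows "\<exists>c. is_expansion (monomial w \<circ> b) c"
proof (induction w)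
  case (Cons j w)
  then obtain c where "is_expansion (monomial w \<circ> b) c" ..
  from expansion_semicircular_comp[OF this, of j] show ?case
    unfolding monomial_Cons comp_assoc .
qed (use assms in auto)

lemma expansion_comp:
  assumes "is_expansion a c" "is_expansion b d"
  shows "\<exists>e. is_expansion (a \<circ> b) e"
proof -
  have "a \<circ> b = (\<lambda>\<xi>. \<Sum>w | c w \<noteq> 0. c w *\<^sub>C (monomial w \<circ> b) \<xi>)"
    using assms(1) by (simp add: is_expansion_def fun_eq_iff)
  moreover have "\<exists>e. is_expansion (\<lambda>\<xi>. \<Sum>w | c w \<noteq> 0. c w *\<^sub>C (monomial w \<circ> b) \<xi>) e"
  proof (rule expansion_sum)
    show "finite {w. c w \<noteq> 0}" using assms(1) by (simp add: is_expansion_def)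
    show "\<exists>e. is_expansion (\<lambda>\<xi>. c w *\<^sub>C (monomial w \<circ> b) \<xi>) e" for w
      using expansion_monomial_comp[OF assms(2), of w] is_expansion_scale by blast
  qed
  ultimately show ?thesis by simp
qed

lemma monomial_in_algebra: "monomial w \<in> semicircular_algebra"
proof (induction w)
  case (Cons j w)
  then show ?case
    unfolding monomial_Cons by (intro semicircular_algebra.mult semicircular_algebra.gen)
qed (simp only: monomial_Nil semicircular_algebra.one)

lemma semicircular_algebra_iff: "a \<in> semicircular_algebra \<longleftrightarrow> (\<exists>c. is_expansion a c)"
proof
  assume "a \<in> semicircular_algebra"
  then show "\<exists>c. is_expansion a c"
  proof induction
    case one
    show ?case using is_expansion_monomial[of "[]"] unfolding monomial_Nil by blast
  next
    case (gen j)
    show ?case using is_expansion_monomial[of "[j]"]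
      unfolding monomial_Cons monomial_Nil comp_id by blast
  qed (blast intro: is_expansion_add is_expansion_scale expansion_comp)+
next
  assume "\<exists>c. is_expansion a c"
  then obtain c where "finite {w. c w \<noteq> 0}" and
    a: "a = (\<lambda>\<xi>. \<Sum>w | c w \<noteq> 0. c w *\<^sub>C monomial w \<xi>)"
    by (auto simp: is_expansion_def)
  have "(\<lambda>\<xi>. \<Sum>w\<in>A. c w *\<^sub>C monomial w \<xi>) \<in> semicircular_algebra" if "finite A" for A
    using that
  proof (induction A rule: finite_induct)
    case empty
    have "(\<lambda>\<xi>. 0 *\<^sub>C id \<xi>) \<in> semicircular_algebra"
      by (intro semicircular_algebra.intros)
    also have "(\<lambda>\<xi>. 0 *\<^sub>C id \<xi>) = (\<lambda>\<xi>. 0 :: 'a fock)"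
      by (rule ext, rule fock_eqI) simp
    finally show ?case by simp
  next
    case (insert w A)
    from semicircular_algebra.add[OF semicircular_algebra.scale[OF monomial_in_algebra] insert(3)]
    show ?case using insert(1,2) by simp
  qed
  with \<open>finite _\<close> a show "a \<in> semicircular_algebra" by blast
qed

lemma semicircular_algebra_expansion:
  "a \<in> semicircular_algebra \<Longrightarrow> \<exists>!c. is_expansion a c"
  using expansion_unique_vacuum unfolding semicircular_algebra_iff by blast

lemma is_expansion_mon_coeff:
  "a \<in> semicircular_algebra \<Longrightarrow> is_expansion a (mon_coeff a)"
  unfolding semicircular_algebra_iff using mon_coeff_eqI by metis

lemma inj_on_vacuum: "inj_on (\<lambda>a. a vacuum) semicircular_algebra"
proof (rule inj_onI)
  fix a b :: "'a fock \<Rightarrow> 'a fock"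
  assume "a \<in> semicircular_algebra" "b \<in> semicircular_algebra" "a vacuum = b vacuum"
  then have "is_expansion a (mon_coeff a)" "is_expansion b (mon_coeff a)"
    using is_expansion_mon_coeff expansion_unique_vacuum by metis+
  then show "a = b" by (simp add: is_expansion_def)
qed

lemma cyclic_derivative_monomial_eq:
  "cyclic_derivative j (monomial w) = cyclic_derivative_monomial j w"
proof -
  have "{v. (if v = w then 1 else 0 :: complex) \<noteq> 0} = {w}" by auto
  then show ?thesis
    by (intro ext fock_eqI)
      (simp only: cyclic_derivative_def mon_coeff_eqI[OF is_expansion_monomial] coeff_sum, simp)
qed

lemma cyclic_derivative_add:
  assumes "a \<in> semicircular_algebra" "b \<in> semicircular_algebra"
  shows "cyclic_derivative j (\<lambda>\<xi>. a \<xi> + b \<xi>) \<xi> = cyclic_derivative j a \<xi> + cyclic_derivative j b \<xi>"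
proof -
  let ?c = "mon_coeff a" and ?d = "mon_coeff b"
  note ab = is_expansion_mon_coeff[OF assms(1)] is_expansion_mon_coeff[OF assms(2)]
  define A where "A = {w. ?c w \<noteq> 0} \<union> {w. ?d w \<noteq> 0}"
  have A: "finite A" "{w. ?c w \<noteq> 0} \<subseteq> A" "{w. ?d w \<noteq> 0} \<subseteq> A" "{w. ?c w + ?d w \<noteq> 0} \<subseteq> A"
    using ab by (auto simp: A_def is_expansion_def)
  let ?f = "\<lambda>w. cyclic_derivative_monomial j w \<xi>"
  have "cyclic_derivative j (\<lambda>\<xi>. a \<xi> + b \<xi>) \<xi> = (\<Sum>w\<in>A. (?c w + ?d w) *\<^sub>C ?f w)"
    unfolding cyclic_derivative_def mon_coeff_eqI[OF is_expansion_add[OF ab]]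
    by (rule expansion_superset[OF A(1,4)])
  also have "\<dots> = (\<Sum>w\<in>A. ?c w *\<^sub>C ?f w) + (\<Sum>w\<in>A. ?d w *\<^sub>C ?f w)"
    unfolding scaleC_add_left by (rule sum.distrib)
  also have "\<dots> = cyclic_derivative j a \<xi> + cyclic_derivative j b \<xi>"
    unfolding cyclic_derivative_def
    by (simp only: expansion_superset[OF A(1,2)] expansion_superset[OF A(1,3)])
  finally show ?thesis .
qed

lemma cyclic_derivative_scale:
  assumes "a \<in> semicircular_algebra"
  shows "cyclic_derivative j (\<lambda>\<xi>. x *\<^sub>C a \<xi>) \<xi> = x *\<^sub>C cyclic_derivative j a \<xi>"
proof -
  note a = is_expansion_mon_coeff[OF assms]
  have A: "finite {w. mon_coeff a w \<noteq> 0}" "{w. x * mon_coeff a w \<noteq> 0} \<subseteq> {w. mon_coeff a w \<noteq> 0}"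
    using a by (auto simp: is_expansion_def)
  show ?thesis
    unfolding cyclic_derivative_def mon_coeff_eqI[OF is_expansion_scale[OF a]] expansion_superset[OF A]
    by (rule fock_eqI) (simp add: sum_distrib_left mult.assoc)
qed

lemma cyclic_derivative_in_algebra:
  assumes "a \<in> semicircular_algebra"
  shows "cyclic_derivative j a \<in> semicircular_algebra"
  unfolding semicircular_algebra_iff cyclic_derivative_def[abs_def] cyclic_derivative_monomial_def
proof (rule expansion_sum)
  show "finite {w. mon_coeff a w \<noteq> 0}"
    using is_expansion_mon_coeff[OF assms] by (simp add: is_expansion_def)
  fix w
  have "\<exists>c. is_expansion
      (\<lambda>\<xi>. \<Sum>k | k < length w \<and> w ! k = j. monomial (drop (Suc k) w @ take k w) \<xi>) c"
    by (rule expansion_sum) (use is_expansion_monomial in auto)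
  then show "\<exists>c. is_expansion (\<lambda>\<xi>. mon_coeff a w *\<^sub>C
      (\<Sum>k | k < length w \<and> w ! k = j. monomial (drop (Suc k) w @ take k w) \<xi>)) c"
    using is_expansion_scale by blast
qed

section \<open>Tuples of vectors and of operators\<close>

definition scaleC_tuple :: "complex \<Rightarrow> 'n fock ^ 'm \<Rightarrow> 'n fock ^ 'm" where
  "scaleC_tuple c v = (\<chi> j. c *\<^sub>C v $ j)"

global_interpretation tuple: vector_space scaleC_tuple
  by standard
    (auto simp: scaleC_tuple_def vec_eq_iff algebra_simps intro!: fock_eqI)

definition cinner_tuple :: "'n fock ^ 'm \<Rightarrow> 'n fock ^ 'm \<Rightarrow> complex" where
  "cinner_tuple v u = (\<Sum>j\<in>UNIV. cinner (v $ j) (u $ j))"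

lemma inner_tuple: "inner v u = Re (cinner_tuple v u)" for v u :: "'n fock ^ 'm"
  by (simp add: inner_vec_def cinner_tuple_def inner_fock_def)

definition orth_complement :: "('n fock ^ 'm) set \<Rightarrow> ('n fock ^ 'm) set" where
  "orth_complement M = {v. \<forall>u\<in>M. cinner_tuple v u = 0}"

text \<open>
  Pitfall: for \<open>n \<ge> 2\<close> the range of \<open>\<xi> \<mapsto> ((\<ell>\<^sub>j\<^sup>* - r\<^sub>j\<^sup>*) \<xi>)\<^sub>j\<close> is not closed: on vectors of length \<open>p\<close>
  it amounts to \<open>1 - U\<close> with \<open>U\<close> the cyclic rotation, whose spectrum contains \<open>exp (2\<pi>i/p)\<close>.
  An orthogonal complement, being closed, can therefore only equal the closure of this range.
\<close>

definition vacuum_tuple :: "('n fock \<Rightarrow> 'n fock) ^ 'm \<Rightarrow> 'n fock ^ 'm" where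
  "vacuum_tuple P = (\<chi> j. (P $ j) vacuum)"

definition cyclic_gradient :: "('n fock \<Rightarrow> 'n fock) \<Rightarrow> ('n fock \<Rightarrow> 'n fock) ^ 'n" where
  "cyclic_gradient R = (\<chi> j. cyclic_derivative j R)"

definition Vect :: "(('n::finite fock \<Rightarrow> 'n fock) ^ 'n) set" where
  "Vect = {P. (\<forall>j. P $ j \<in> semicircular_algebra) \<and>
     (\<forall>R\<in>semicircular_algebra. (\<Sum>j\<in>UNIV. vac_state (P $ j \<circ> cyclic_gradient R $ j)) = 0)}"

text \<open>The generator attached to \<open>(i\<^sub>0, \<dots>, i\<^sub>k)\<close>; only used on words of length at least \<open>2\<close>.\<close>

definition X_generator :: "'n list \<Rightarrow> 'n fock ^ 'n" where
  "X_generator w =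
     (\<chi> j. (if j = hd w then basis (tl w) else 0) - (if j = last w then basis (butlast w) else 0))"

definition X_space :: "nat \<Rightarrow> ('n::finite fock ^ 'n) set" where
  "X_space k = (if k = 0 then {0} else tuple.span {X_generator w | w. length w = Suc k})"

definition algebraic_sum :: "(nat \<Rightarrow> ('n fock ^ 'm) set) \<Rightarrow> ('n fock ^ 'm) set" where
  "algebraic_sum X = {\<Sum>k\<in>F. x k | F x. finite F \<and> (\<forall>k\<in>F. x k \<in> X k)}"

end

theory Submission
  imports Defs
begin

text \<open>
  Let \<open>C\<^sub>w\<close> be the tuple obtained from the basis vector of the word \<open>w\<close> by the cyclic gradient for
  the free variables \<open>e\<^sub>j\<close>. Since \<open>\<Sum>\<^sub>j [s\<^sub>j, \<delta>\<^sub>j R] = 0\<close> and right multiplication by \<open>s\<^sub>j\<close> acts as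
  \<open>r\<^sub>j + r\<^sub>j\<^sup>*\<close>, the gradient vectors are invariant under cyclic rotation of words; by triangularity
  with respect to the degree they span the same space as the \<open>C\<^sub>w\<close>. A tuple is orthogonal to all
  \<open>C\<^sub>w\<close> iff its coefficients sum to zero along every orbit of rotations. On words of bounded length
  this means being a coboundary \<open>\<xi> - \<xi> \<circ> rotate1\<close>, which is \<open>((\<ell>\<^sub>j\<^sup>* - r\<^sub>j\<^sup>*) \<xi>)\<^sub>j\<close>; truncating the word
  length preserves the zero sums and gives the closure of the range.
\<close>

section \<open>Inner products and adjoints\<close>

lemma cinner_add_right: "cinner \<xi> (\<eta> + \<zeta>) = cinner \<xi> \<eta> + cinner \<xi> \<zeta>"
  by (subst (1 2 3) cinner_commute) (simp add: cinner_add_left)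

lemma cinner_scaleC_right: "cinner \<xi> (c *\<^sub>C \<eta>) = cnj c * cinner \<xi> \<eta>"
  by (subst (1 2) cinner_commute) (simp add: cinner_scaleC_left)

lemma cinner_zero_left [simp]: "cinner 0 \<xi> = 0"
  by (simp add: cinner_def)

lemma cinner_zero_right [simp]: "cinner \<xi> 0 = 0"
  by (simp add: cinner_def)

lemma cinner_sum_left: "cinner (sum f A) \<xi> = (\<Sum>x\<in>A. cinner (f x) \<xi>)"
  by (induction A rule: infinite_finite_induct) (auto simp: cinner_add_left)

lemma cinner_sum_right: "cinner \<xi> (sum f A) = (\<Sum>x\<in>A. cinner \<xi> (f x))"
  by (induction A rule: infinite_finite_induct) (auto simp: cinner_add_right)

lemma cinner_basis_right: "cinner \<xi> (basis w) = coeff \<xi> w"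
  by (subst cinner_commute) (simp add: cinner_basis_left)

text \<open>Only words beginning with \<open>j\<close> contribute to the pairing, and stripping that
  letter reindexes the sum.\<close>

lemma cinner_lcreate_left: "cinner (lcreate j \<xi>) \<eta> = cinner \<xi> (lannihilate j \<eta>)"
proof -
  have "cinner (lcreate j \<xi>) \<eta> =
      (\<Sum>\<^sub>\<infinity>w\<in>range ((#) j). coeff (lcreate j \<xi>) w * cnj (coeff \<eta> w))"
    unfolding cinner_def
  proof (rule infsum_cong_neutral)
    fix w assume "w \<in> UNIV - range ((#) j)"
    then show "coeff (lcreate j \<xi>) w * cnj (coeff \<eta> w) = 0"
      by (cases w) (auto simp: coeff_lcreate)
  qed auto
  also have "\<dots> = cinner \<xi> (lannihilate j \<eta>)"
    unfolding cinner_def by (subst infsum_reindex) (auto simp: o_def coeff_lcreate)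
  finally show ?thesis .
qed

lemma cinner_lcreate_right: "cinner \<xi> (lcreate j \<eta>) = cinner (lannihilate j \<xi>) \<eta>"
  by (subst (1 2) cinner_commute) (simp add: cinner_lcreate_left)

lemma cinner_semicircular: "cinner (semicircular j \<xi>) \<eta> = cinner \<xi> (semicircular j \<eta>)"
  by (simp add: semicircular_def cadjoint_lcreate cinner_add_left cinner_add_right
      cinner_lcreate_left cinner_lcreate_right)

lemma monomial_append: "monomial (u @ w) = monomial u \<circ> monomial w"
  by (induction u) (auto simp: comp_assoc)

lemma cinner_monomial: "cinner (monomial w \<xi>) \<eta> = cinner \<xi> (monomial (rev w) \<eta>)"
  by (induction w arbitrary: \<xi> \<eta>) (auto simp: monomial_append cinner_semicircular)

section \<open>Right semicircular operators\<close>

definition rsemicircular :: "'n \<Rightarrow> 'n fock \<Rightarrow> 'n fock" where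
  "rsemicircular j \<xi> = rcreate j \<xi> + rannihilate j \<xi>"

lemma coeff_rcreate_eq:
  "coeff (rcreate j \<xi>) w = (if w \<noteq> [] \<and> last w = j then coeff \<xi> (butlast w) else 0)"
  by transfer simp

lemma coeff_rsemicircular:
  "coeff (rsemicircular j \<xi>) w =
     (if w \<noteq> [] \<and> last w = j then coeff \<xi> (butlast w) else 0) + coeff \<xi> (w @ [j])"
  by (simp add: rsemicircular_def coeff_rcreate_eq)

text \<open>Left and right operators act at opposite ends of a word. Only left creation with right
  annihilation, and left annihilation with right creation, fail to commute; these two commutators
  are opposite multiples of the vacuum projection and cancel.\<close>

lemma semicircular_rsemicircular_commute:
  "semicircular i (rsemicircular j \<xi>) = rsemicircular j (semicircular i \<xi>)"
proof (rule fock_eqI)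
  fix w :: "'a list"
  consider "w = []" | x where "w = [x]" | x v y where "w = x # v @ [y]"
    by (metis append_butlast_last_id neq_Nil_conv)
  then show "coeff (semicircular i (rsemicircular j \<xi>)) w =
      coeff (rsemicircular j (semicircular i \<xi>)) w"
    by cases (auto simp: coeff_semicircular coeff_rsemicircular butlast_append)
qed

lemma monomial_rsemicircular: "monomial w (rsemicircular j \<xi>) = rsemicircular j (monomial w \<xi>)"
  by (induction w) (auto simp: semicircular_rsemicircular_commute)

lemma semicircular_vacuum: "semicircular j vacuum = rsemicircular j vacuum"
proof (rule fock_eqI)
  fix w show "coeff (semicircular j vacuum) w = coeff (rsemicircular j vacuum) w"
    by (cases w)
      (auto simp: coeff_semicircular coeff_rsemicircular vacuum_def coeff_basis butlast_conv_take)
qed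

text \<open>The appended generator meets the vacuum first, where left and right versions agree; as a
  right operator it then commutes past \<open>monomial w\<close>.\<close>

lemma monomial_snoc_vacuum: "monomial (w @ [j]) vacuum = rsemicircular j (monomial w vacuum)"
  by (simp add: monomial_append semicircular_vacuum monomial_rsemicircular)

section \<open>Adjoints of polynomials, seen on vacuum vectors\<close>

lift_definition conj_flip :: "'n fock \<Rightarrow> 'n fock" is "\<lambda>f w. cnj (f (rev w))"
  using square_summable_comp_inj[of rev] by (auto simp: square_summable_def)

lemma coeff_conj_flip [simp]: "coeff (conj_flip \<xi>) w = cnj (coeff \<xi> (rev w))"
  by transfer simp

lemma conj_flip_scaleC: "conj_flip (c *\<^sub>C \<xi>) = cnj c *\<^sub>C conj_flip \<xi>"
  by (rule fock_eqI) simp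

lemma conj_flip_sum: "conj_flip (sum f A) = (\<Sum>x\<in>A. conj_flip (f x))"
  by (rule fock_eqI) simp

lemma conj_flip_semicircular: "conj_flip (semicircular j \<xi>) = rsemicircular j (conj_flip \<xi>)"
proof (rule fock_eqI)
  fix w show "coeff (conj_flip (semicircular j \<xi>)) w = coeff (rsemicircular j (conj_flip \<xi>)) w"
    by (cases w rule: rev_cases) (auto simp: coeff_semicircular coeff_rsemicircular)
qed

lemma conj_flip_monomial_vacuum: "conj_flip (monomial w vacuum) = monomial (rev w) vacuum"
proof (induction w)
  case Nil
  then show ?case by (auto intro!: fock_eqI simp: vacuum_def coeff_basis)
next
  case (Cons j w)
  then show ?case by (simp add: conj_flip_semicircular monomial_snoc_vacuum)
qed

text \<open>The conjugate flip implements \<open>a 1 \<mapsto> a\<^sup>* 1\<close>.\<close>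

lemma cinner_algebra_vacuum:
  assumes "a \<in> semicircular_algebra"
  shows "cinner (a \<xi>) vacuum = cinner \<xi> (conj_flip (a vacuum))"
proof -
  from assms have a: "a = (\<lambda>\<xi>. \<Sum>w | mon_coeff a w \<noteq> 0. mon_coeff a w *\<^sub>C monomial w \<xi>)"
    using is_expansion_mon_coeff is_expansion_def by metis
  show ?thesis
    by (subst (1 2) a)
      (simp add: cinner_sum_left cinner_scaleC_left cinner_monomial conj_flip_sum
        conj_flip_scaleC conj_flip_monomial_vacuum cinner_sum_right cinner_scaleC_right)
qed

section \<open>Vectors of finite degree\<close>

text \<open>For a finite alphabet this is the algebraic direct sum of the tensor powers;
  \<open>vacuum_image\<close> identifies it with the polynomials applied to the vacuum.\<close>

definition finite_degree :: "'n fock set" where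
  "finite_degree = {\<xi>. \<exists>N. \<forall>w. N \<le> length w \<longrightarrow> coeff \<xi> w = 0}"

lemma finite_words_less: "finite {w :: 'n::finite list. length w < N}"
  by (rule finite_subset[OF _ finite_lists_length_le[of "UNIV :: 'n set" N]]) auto

lemma finite_degree_zero: "0 \<in> finite_degree"
  by (simp add: finite_degree_def)

lemma finite_degree_scaleC: "\<xi> \<in> finite_degree \<Longrightarrow> c *\<^sub>C \<xi> \<in> finite_degree"
  by (auto simp: finite_degree_def)

lemma finite_degree_add:
  assumes "\<xi> \<in> finite_degree" "\<eta> \<in> finite_degree"
  shows "\<xi> + \<eta> \<in> finite_degree"
proof -
  obtain N K where "\<forall>w. N \<le> length w \<longrightarrow> coeff \<xi> w = 0" "\<forall>w. K \<le> length w \<longrightarrow> coeff \<eta> w = 0"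
    using assms by (auto simp: finite_degree_def)
  then have "\<forall>w. max N K \<le> length w \<longrightarrow> coeff (\<xi> + \<eta>) w = 0" by simp
  then show ?thesis unfolding finite_degree_def by blast
qed

lemma finite_degree_sum: "(\<And>x. x \<in> A \<Longrightarrow> f x \<in> finite_degree) \<Longrightarrow> sum f A \<in> finite_degree"
  by (induction A rule: infinite_finite_induct) (auto intro: finite_degree_zero finite_degree_add)

lemma finite_degree_monomial: "monomial w vacuum \<in> finite_degree"
  unfolding finite_degree_def using coeff_monomial_vacuum[of w]
  by (auto intro!: exI[of _ "Suc (length w)"])

lemma finite_degree_basis: "basis w \<in> finite_degree"
  unfolding finite_degree_def by (auto simp: coeff_basis intro!: exI[of _ "Suc (length w)"])

lemma finite_degree_algebra:
  assumes "a \<in> semicircular_algebra"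
  shows "a vacuum \<in> finite_degree"
proof -
  from assms have "a = (\<lambda>\<xi>. \<Sum>w | mon_coeff a w \<noteq> 0. mon_coeff a w *\<^sub>C monomial w \<xi>)"
    using is_expansion_mon_coeff is_expansion_def by metis
  then have "a vacuum = (\<Sum>w | mon_coeff a w \<noteq> 0. mon_coeff a w *\<^sub>C monomial w vacuum)"
    by (rule fun_cong)
  then show ?thesis
    by (simp only:) (intro finite_degree_sum finite_degree_scaleC finite_degree_monomial)
qed

definition truncate :: "nat \<Rightarrow> 'n::finite fock \<Rightarrow> 'n fock" where
  "truncate N \<xi> = (\<Sum>w | length w < N. coeff \<xi> w *\<^sub>C basis w)"

lemma coeff_truncate: "coeff (truncate N \<xi>) v = (if length v < N then coeff \<xi> v else 0)"
proof -
  have "coeff (truncate N \<xi>) v = (\<Sum>w | length w < N. if w = v then coeff \<xi> v else 0)"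
    unfolding truncate_def coeff_sum by (rule sum.cong) (auto simp: coeff_basis)
  then show ?thesis by (simp add: finite_words_less)
qed

lemma basis_expansion:
  fixes \<xi> :: "'n::finite fock"
  assumes "\<And>w. N \<le> length w \<Longrightarrow> coeff \<xi> w = 0"
  shows "\<xi> = (\<Sum>w | length w < N. coeff \<xi> w *\<^sub>C basis w)"
  unfolding truncate_def[symmetric] by (rule fock_eqI) (use assms in \<open>auto simp: coeff_truncate\<close>)

lemma vacuum_image_sum:
  assumes "finite A" "\<And>x. x \<in> A \<Longrightarrow> f x \<in> (\<lambda>a. a vacuum) ` semicircular_algebra"
  shows "(\<Sum>x\<in>A. c x *\<^sub>C f x) \<in> (\<lambda>a. a vacuum) ` semicircular_algebra"
  using assms
proof (induction A rule: finite_induct)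
  case empty
  \<comment> \<open>The zero operator is not among the generating rules of the algebra; it enters as
    \<open>id\<close> scaled by 0.\<close>
  show ?case
    by (rule image_eqI[OF _ semicircular_algebra.scale[OF semicircular_algebra.one, of 0]])
      (auto intro: fock_eqI)
next
  case (insert x A)
  from insert obtain a where "a \<in> semicircular_algebra" "f x = a vacuum" by blast
  moreover from insert obtain b
    where "b \<in> semicircular_algebra" "(\<Sum>x\<in>A. c x *\<^sub>C f x) = b vacuum" by blast
  ultimately show ?case using insert(1,2)
    by (intro image_eqI[of _ _ "\<lambda>\<xi>. c x *\<^sub>C a \<xi> + b \<xi>"] semicircular_algebra.add
        semicircular_algebra.scale) simp_all
qed

text \<open>Triangularity: \<open>monomial w vacuum\<close> is \<open>basis w\<close> plus terms of lower degree.\<close>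

lemma basis_vacuum_image:
  fixes w :: "'n::finite list"
  shows "basis w \<in> (\<lambda>a. a vacuum) ` semicircular_algebra"
proof (induction w rule: measure_induct_rule[of length])
  case (less w)
  define \<xi> where "\<xi> = monomial w vacuum - basis w"
  have "\<xi> = (\<Sum>v | length v < length w. coeff \<xi> v *\<^sub>C basis v)"
    by (rule basis_expansion) (simp add: \<xi>_def coeff_monomial_vacuum coeff_basis)
  moreover have "\<dots> \<in> (\<lambda>a. a vacuum) ` semicircular_algebra"
    using less by (intro vacuum_image_sum) (auto simp: finite_words_less)
  ultimately obtain a where a: "a \<in> semicircular_algebra" "\<xi> = a vacuum" by auto
  have "basis w = monomial w vacuum + (- 1) *\<^sub>C \<xi>"
    by (rule fock_eqI) (simp add: \<xi>_def)
  with a show ?case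
    by (intro image_eqI[OF _ semicircular_algebra.add[OF monomial_in_algebra[of w]
          semicircular_algebra.scale[of a "- 1"]]]) auto
qed

lemma vacuum_image:
  "(\<lambda>a. a vacuum) ` semicircular_algebra = (finite_degree :: 'n::finite fock set)"
proof
  show "finite_degree \<subseteq> (\<lambda>a. a vacuum) ` (semicircular_algebra :: ('n fock \<Rightarrow> 'n fock) set)"
  proof
    fix \<xi> :: "'n fock" assume "\<xi> \<in> finite_degree"
    then obtain N where "\<And>w. N \<le> length w \<Longrightarrow> coeff \<xi> w = 0" by (auto simp: finite_degree_def)
    then have "\<xi> = (\<Sum>w | length w < N. coeff \<xi> w *\<^sub>C basis w)" by (rule basis_expansion)
    moreover have "\<dots> \<in> (\<lambda>a. a vacuum) ` semicircular_algebra"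
      by (intro vacuum_image_sum basis_vacuum_image finite_words_less)
    ultimately show "\<xi> \<in> (\<lambda>a. a vacuum) ` semicircular_algebra" by simp
  qed
qed (auto intro: finite_degree_algebra)

text \<open>The squared error is the tail of the series of squared moduli, and the sets of words
  shorter than \<open>N\<close> eventually contain every finite set of words.\<close>

lemma truncate_tendsto: "(\<lambda>N. truncate N \<xi>) \<longlonglongrightarrow> \<xi>"
proof -
  define f where "f = (\<lambda>w. (cmod (coeff \<xi> w))\<^sup>2)"
  have f: "(f has_sum infsum f UNIV) UNIV"
    using square_summable_coeff[of \<xi>] by (simp add: f_def square_summable_def)
  have "filterlim (\<lambda>N. {w :: 'a list. length w < N}) (finite_subsets_at_top UNIV) sequentially"
    unfolding filterlim_finite_subsets_at_top
  proof (intro allI impI)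
    fix X :: "'a list set" assume "finite X \<and> X \<subseteq> UNIV"
    then obtain K where "\<forall>w\<in>X. length w < K"
      using finite_nat_set_iff_bounded[of "length ` X"] by auto
    then show "\<forall>\<^sub>F N in sequentially.
        finite {w :: 'a list. length w < N} \<and> X \<subseteq> {w. length w < N} \<and> {w. length w < N} \<subseteq> UNIV"
      by (intro eventually_sequentiallyI[of K]) (force simp: finite_words_less)
  qed
  from filterlim_compose[OF f[unfolded has_sum_def] this]
  have "(\<lambda>N. infsum f UNIV - sum f {w. length w < N}) \<longlonglongrightarrow> infsum f UNIV - infsum f UNIV"
    by (intro tendsto_intros)
  moreover have "infsum f UNIV - sum f {w. length w < N} = (norm (truncate N \<xi> - \<xi>))\<^sup>2" for N
  proof -
    have "(f has_sum infsum f UNIV - sum f {w. length w < N}) (UNIV - {w. length w < N})"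
      by (intro has_sum_Diff f has_sum_finite finite_words_less) auto
    then have "infsum f UNIV - sum f {w. length w < N} = infsum f (UNIV - {w. length w < N})"
      by (simp add: infsumI)
    also have "\<dots> = (\<Sum>\<^sub>\<infinity>w. (cmod (coeff (truncate N \<xi> - \<xi>) w))\<^sup>2)"
      by (rule infsum_cong_neutral) (auto simp: coeff_truncate f_def)
    also have "\<dots> = (norm (truncate N \<xi> - \<xi>))\<^sup>2"
      unfolding power2_norm_eq_inner[of "truncate N \<xi> - \<xi>"] by (simp add: inner_fock_def cinner_self)
    finally show ?thesis .
  qed
  ultimately have "(\<lambda>N. (norm (truncate N \<xi> - \<xi>))\<^sup>2) \<longlonglongrightarrow> 0" by simp
  then have "(\<lambda>N. sqrt ((norm (truncate N \<xi> - \<xi>))\<^sup>2)) \<longlonglongrightarrow> sqrt 0" by (rule tendsto_real_sqrt)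
  then have "(\<lambda>N. truncate N \<xi> - \<xi>) \<longlonglongrightarrow> 0" by (simp add: tendsto_norm_zero_iff)
  then show ?thesis by (simp add: LIM_zero_iff)
qed

section \<open>Tuples as functions on nonempty words\<close>

text \<open>
  A tuple \<open>v\<close> is encoded by \<open>j # w \<mapsto> coeff (v $ j) w\<close>; the value at the empty word is junk.
  Cyclic rotation of words then governs both the cyclic gradient and \<open>\<ell>\<^sub>j\<^sup>* - r\<^sub>j\<^sup>*\<close>.
\<close>

definition word_coeff :: "'n fock ^ 'n \<Rightarrow> 'n list \<Rightarrow> complex" where
  "word_coeff v w = coeff (v $ hd w) (tl w)"

lemma word_coeff_Cons [simp]: "word_coeff v (j # w) = coeff (v $ j) w"
  by (simp add: word_coeff_def)

lemma word_coeff_add: "word_coeff (v + u) w = word_coeff v w + word_coeff u w"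
  and word_coeff_diff: "word_coeff (v - u) w = word_coeff v w - word_coeff u w"
  and word_coeff_scaleC: "word_coeff (scaleC_tuple c v) w = c * word_coeff v w"
  by (simp_all add: word_coeff_def scaleC_tuple_def)

lemma word_coeff_zero: "word_coeff 0 w = 0"
  by (simp add: word_coeff_def)

lemma word_coeff_sum: "word_coeff (sum f A) w = (\<Sum>x\<in>A. word_coeff (f x) w)"
  by (induction A rule: infinite_finite_induct) (auto simp: word_coeff_add word_coeff_zero)

lemma word_coeff_eqI: "(\<And>w. w \<noteq> [] \<Longrightarrow> word_coeff v w = word_coeff u w) \<Longrightarrow> v = u"
  unfolding vec_eq_iff by (metis fock_eqI list.distinct(1) word_coeff_Cons)

lemma finite_degree_tuple:
  fixes v :: "'n::finite fock ^ 'n"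
  shows "(\<forall>j. v $ j \<in> finite_degree) \<longleftrightarrow> (\<exists>N. \<forall>w. N \<le> length w \<longrightarrow> word_coeff v w = 0)"
proof
  assume "\<forall>j. v $ j \<in> finite_degree"
  then obtain N where N: "\<And>j w. N j \<le> length w \<Longrightarrow> coeff (v $ j) w = 0"
    unfolding finite_degree_def mem_Collect_eq by metis
  have "word_coeff v w = 0" if "Suc (Max (range N)) \<le> length w" for w
    unfolding word_coeff_def
  proof (rule N)
    have "N (hd w) \<le> Max (range N)" by (rule Max_ge) auto
    also have "\<dots> \<le> length (tl w)" using that unfolding length_tl by linarith
    finally show "N (hd w) \<le> length (tl w)" .
  qed
  then show "\<exists>N. \<forall>w. N \<le> length w \<longrightarrow> word_coeff v w = 0" by blast
next
  assume "\<exists>N. \<forall>w. N \<le> length w \<longrightarrow> word_coeff v w = 0"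
  then obtain N where "\<And>w. N \<le> length w \<Longrightarrow> word_coeff v w = 0" by blast
  from this[of "_ # _"] show "\<forall>j. v $ j \<in> finite_degree"
    unfolding finite_degree_def by (auto intro!: exI[of _ N])
qed

text \<open>The summand of the cyclic gradient at position \<open>k\<close> is the tail of
  \<open>rotate k w\<close>; the head is the variable being differentiated.\<close>

lemma rotate_eq_Cons:
  "k < length w \<Longrightarrow> rotate k w = w ! k # drop (Suc k) w @ take k w"
  by (simp add: rotate_drop_take Cons_nth_drop_Suc)

lemma rotate_Suc_eq_snoc:
  assumes "k < length w"
  shows "rotate (Suc k) w = drop (Suc k) w @ take k w @ [w ! k]"
  using rotate_eq_Cons[OF assms] by simp

lemma sum_rotate_Suc:
  fixes f :: "'b list \<Rightarrow> 'c::ab_group_add"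
  shows "(\<Sum>k<length w. f (rotate (Suc k) w)) = (\<Sum>k<length w. f (rotate k w))"
proof -
  have "(\<Sum>k<length w. f (rotate (Suc k) w) - f (rotate k w)) = 0"
    by (subst sum_lessThan_telescope[of "\<lambda>k. f (rotate k w)"]) simp
  then show ?thesis by (simp only: sum_subtractf right_minus_eq)
qed

lemma sum_filter_lessThan:
  "(\<Sum>k | k < n \<and> P k. f k) = (\<Sum>k<n. if P k then f k else 0)" for n :: nat
  by (subst sum.inter_filter[symmetric]) auto

lemma sum_positions:
  fixes w :: "'n::finite list"
  shows "(\<Sum>j\<in>UNIV. \<Sum>k | k < length w \<and> w ! k = j. f j k) = (\<Sum>k<length w. f (w ! k) k)"
  unfolding sum_filter_lessThan by (subst sum.swap) simp

text \<open>An orbit sum with multiplicity: a periodic word repeats its rotations, so no primitive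
  period has to be chosen. It is 0 on the empty word, so the junk value of \<open>word_coeff\<close>
  never enters.\<close>

definition cyclic_sum :: "'n fock ^ 'n \<Rightarrow> 'n list \<Rightarrow> complex" where
  "cyclic_sum v w = (\<Sum>k<length w. word_coeff v (rotate k w))"

text \<open>The cyclic gradient of the word \<open>w\<close> for the free variables \<open>e\<^sub>j\<close> in place of \<open>s\<^sub>j\<close>.\<close>

definition cyclic_vector :: "'n list \<Rightarrow> 'n fock ^ 'n" where
  "cyclic_vector w =
     (\<chi> j. \<Sum>k | k < length w \<and> w ! k = j. basis (drop (Suc k) w @ take k w))"

lemma cinner_tuple_cyclic_vector: "cinner_tuple v (cyclic_vector w) = cyclic_sum v w"
  by (simp add: cinner_tuple_def cyclic_vector_def cinner_sum_right cinner_basis_right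
      sum_positions cyclic_sum_def rotate_eq_Cons)

lemma word_coeff_positions:
  assumes "x \<noteq> []"
  shows "word_coeff (\<chi> j. \<Sum>k | k < length w \<and> w ! k = j. f (drop (Suc k) w @ take k w)) x =
     (\<Sum>k<length w. if hd (rotate k w) = hd x then coeff (f (tl (rotate k w))) (tl x) else 0)"
  by (auto simp: word_coeff_def sum_filter_lessThan rotate_eq_Cons intro!: sum.cong)

lemma word_coeff_cyclic_vector:
  assumes "x \<noteq> []"
  shows "word_coeff (cyclic_vector w) x = (\<Sum>k<length w. if rotate k w = x then 1 else 0)"
  unfolding cyclic_vector_def word_coeff_positions[OF assms]
proof (rule sum.cong[OF refl])
  fix k assume "k \<in> {..<length w}"
  then have "rotate k w \<noteq> []" by auto
  then have "rotate k w = x \<longleftrightarrow> hd (rotate k w) = hd x \<and> tl (rotate k w) = tl x"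
    using assms by (auto intro: list.expand)
  then show "(if hd (rotate k w) = hd x then coeff (basis (tl (rotate k w))) (tl x) else 0) =
      (if rotate k w = x then 1 else 0)"
    by (auto simp: coeff_basis)
qed

section \<open>Cyclically invariant tuples and the cyclic gradient\<close>

text \<open>An invariant tuple is constant on orbits. For each \<open>k\<close> exactly one
  \<open>w\<close> satisfies \<open>rotate k w = x\<close>, so \<open>x\<close> is hit
  \<open>length x\<close> times in total, which the division undoes.\<close>

lemma cyclic_invariant_expansion:
  fixes u :: "'n::finite fock ^ 'n"
  assumes inv: "\<And>x. word_coeff u (rotate1 x) = word_coeff u x"
    and deg: "\<And>x. N \<le> length x \<Longrightarrow> word_coeff u x = 0"
  shows "u = (\<Sum>w | length w < N.
           scaleC_tuple (word_coeff u w / of_nat (length w)) (cyclic_vector w))" (is "u = ?r")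
proof (rule word_coeff_eqI)
  fix x :: "'n list" assume "x \<noteq> []"
  let ?c = "word_coeff u x / of_nat (length x)"
  have inv': "word_coeff u (rotate k y) = word_coeff u y" for k y
    by (induction k) (auto simp: inv)
  have "word_coeff ?r x = (\<Sum>w | length w < N. \<Sum>k<length x. if rotate k w = x then ?c else 0)"
    unfolding word_coeff_sum word_coeff_scaleC word_coeff_cyclic_vector[OF \<open>x \<noteq> []\<close>]
  proof (rule sum.cong[OF refl])
    fix w :: "'n list"
    show "word_coeff u w / of_nat (length w) * (\<Sum>k<length w. if rotate k w = x then 1 else 0) =
        (\<Sum>k<length x. if rotate k w = x then ?c else 0)"
    proof (cases "length w = length x")
      case True
      then show ?thesis
        unfolding sum_distrib_left by (intro sum.cong) (auto simp: inv')
    next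
      case False
      then have "rotate k w \<noteq> x" for k by (metis length_rotate)
      then show ?thesis by simp
    qed
  qed
  also have "\<dots> = (\<Sum>k<length x. \<Sum>w | length w < N. if rotate k w = x then ?c else 0)"
    by (rule sum.swap)
  also have "\<dots> = (\<Sum>k<length x. if length x < N then ?c else 0)"
  proof (rule sum.cong[OF refl])
    fix k assume "k \<in> {..<length x}"
    then have "rotate k w = x \<longleftrightarrow> w = rotate (length x - k) x" for w
      by (auto simp: rotate_rotate)
    then show "(\<Sum>w | length w < N. if rotate k w = x then ?c else 0) =
        (if length x < N then ?c else 0)"
      by (simp add: finite_words_less)
  qed
  also have "\<dots> = word_coeff u x"
    using deg[of x] \<open>x \<noteq> []\<close> by auto
  finally show "word_coeff u x = word_coeff ?r x" ..
qed

text \<open>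
  Read off coefficientwise, the commutator identity says that the defect \<open>V\<close> of cyclic invariance
  satisfies \<open>V x = (\<Sum>j. V (j # j # x))\<close>; as \<open>V\<close> vanishes on long words, it vanishes.
\<close>

lemma cyclic_invariant_of_commutator:
  fixes u :: "'n::finite fock ^ 'n"
  assumes comm: "(\<Sum>j\<in>UNIV. semicircular j (u $ j)) = (\<Sum>j\<in>UNIV. rsemicircular j (u $ j))"
    and deg: "\<And>x. N \<le> length x \<Longrightarrow> word_coeff u x = 0"
  shows "word_coeff u (rotate1 x) = word_coeff u x"
proof (induction "N - length x" arbitrary: x rule: less_induct)
  case less
  show ?case
  proof (cases x)
    case Nil
    then show ?thesis by simp
  next
    case x: (Cons i y)
    show ?thesis
    proof (cases "N \<le> length x")
      case True
      then show ?thesis by (simp add: deg)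
    next
      case False
      \<comment> \<open>At \<open>y @ [i]\<close> the creation parts give the two values to be
        compared. The annihilation parts give words two letters longer than \<open>x\<close> that
        are rotations of each other, so the induction hypothesis cancels them.\<close>
      have "coeff (\<Sum>j\<in>UNIV. semicircular j (u $ j)) (y @ [i]) =
          word_coeff u (y @ [i]) + (\<Sum>j\<in>UNIV. word_coeff u (j # j # y @ [i]))"
        by (cases y) (simp_all add: coeff_semicircular sum.distrib)
      moreover have "coeff (\<Sum>j\<in>UNIV. rsemicircular j (u $ j)) (y @ [i]) =
          word_coeff u (i # y) + (\<Sum>j\<in>UNIV. word_coeff u (j # y @ [i, j]))"
        by (simp add: coeff_rsemicircular sum.distrib)
      moreover have "word_coeff u (j # y @ [i, j]) = word_coeff u (j # j # y @ [i])" for j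
        using less[of "j # j # y @ [i]"] False x by simp
      ultimately have "word_coeff u (y @ [i]) = word_coeff u (i # y)"
        using comm by simp
      then show ?thesis by (simp add: x)
    qed
  qed
qed

section \<open>The space of cyclic gradients\<close>

definition gradient_space :: "('n::finite fock ^ 'n) set" where
  "gradient_space = {vacuum_tuple (cyclic_gradient R) | R. R \<in> semicircular_algebra}"

lemma gradient_monomial:
  "vacuum_tuple (cyclic_gradient (monomial w)) =
     (\<chi> j. \<Sum>k | k < length w \<and> w ! k = j. monomial (drop (Suc k) w @ take k w) vacuum)"
  by (simp add: vacuum_tuple_def cyclic_gradient_def cyclic_derivative_monomial_eq
      cyclic_derivative_monomial_def)

text \<open>Each summand is a monomial of degree \<open>length w - 1\<close>, read at the word
  \<open>tl x\<close>, which is at least that long; there only the leading basis vector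
  survives.\<close>

lemma word_coeff_gradient_monomial:
  assumes "length w \<le> length x"
  shows "word_coeff (vacuum_tuple (cyclic_gradient (monomial w))) x =
     word_coeff (cyclic_vector w) x"
proof (cases "x = []")
  case True
  then show ?thesis using assms
    by (simp add: gradient_monomial cyclic_vector_def word_coeff_def del: monomial_Nil)
next
  case False
  then show ?thesis using assms
    unfolding gradient_monomial cyclic_vector_def word_coeff_positions[OF False, where f = basis]
      word_coeff_positions[OF False, where f = "\<lambda>v. monomial v vacuum"]
    by (intro sum.cong refl) (auto simp: coeff_basis coeff_monomial_vacuum)
qed

lemma rsemicircular_add: "rsemicircular j (\<xi> + \<eta>) = rsemicircular j \<xi> + rsemicircular j \<eta>"
  by (rule fock_eqI) (simp add: coeff_rsemicircular)

lemma rsemicircular_sum: "rsemicircular j (sum f A) = (\<Sum>x\<in>A. rsemicircular j (f x))"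
proof (induction A rule: infinite_finite_induct)
  case (infinite A)
  then show ?case by (auto intro!: fock_eqI simp: coeff_rsemicircular)
next
  case empty
  then show ?case by (auto intro!: fock_eqI simp: coeff_rsemicircular)
qed (simp add: rsemicircular_add)

text \<open>Restoring the removed letter on the left or on the right of each summand gives the same
  cyclic list of rotations of \<open>w\<close>; this is the commutator identity.\<close>

lemma gradient_monomial_invariant:
  fixes w :: "'n::finite list"
  shows "word_coeff (vacuum_tuple (cyclic_gradient (monomial w))) (rotate1 x) =
    word_coeff (vacuum_tuple (cyclic_gradient (monomial w))) x"
proof -
  define u where "u = vacuum_tuple (cyclic_gradient (monomial w))"
  have comm: "(\<Sum>j\<in>UNIV. semicircular j (u $ j)) = (\<Sum>j\<in>UNIV. rsemicircular j (u $ j))"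
  proof -
    have "(\<Sum>j\<in>UNIV. semicircular j (u $ j)) = (\<Sum>k<length w. monomial (rotate k w) vacuum)"
      by (simp add: u_def gradient_monomial semicircular_sum sum_positions rotate_eq_Cons)
    also have "\<dots> = (\<Sum>k<length w. monomial (rotate (Suc k) w) vacuum)"
      by (rule sum_rotate_Suc[symmetric])
    also have "\<dots> = (\<Sum>j\<in>UNIV. rsemicircular j (u $ j))"
      by (simp add: u_def gradient_monomial rsemicircular_sum sum_positions rotate_Suc_eq_snoc
          monomial_snoc_vacuum[of "_ @ _", simplified] del: rotate_Suc)
    finally show ?thesis .
  qed
  have "\<forall>j. u $ j \<in> finite_degree"
    by (auto simp: u_def gradient_monomial intro: finite_degree_sum finite_degree_monomial)
  then obtain N where "\<And>x. N \<le> length x \<Longrightarrow> word_coeff u x = 0"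
    unfolding finite_degree_tuple by blast
  from cyclic_invariant_of_commutator[OF comm this] show ?thesis unfolding u_def .
qed

lemma gradient_expansion:
  assumes "R \<in> semicircular_algebra"
  shows "vacuum_tuple (cyclic_gradient R) = (\<Sum>w | mon_coeff R w \<noteq> 0.
     scaleC_tuple (mon_coeff R w) (vacuum_tuple (cyclic_gradient (monomial w))))"
  by (simp add: vec_eq_iff vacuum_tuple_def cyclic_gradient_def cyclic_derivative_def[of _ R]
      cyclic_derivative_monomial_eq scaleC_tuple_def)

lemma subspace_gradient_space: "tuple.subspace gradient_space"
proof (rule tuple.subspaceI)
  have *: "(\<lambda>\<xi>. 0 *\<^sub>C id \<xi>) \<in> (semicircular_algebra :: ('a fock \<Rightarrow> 'a fock) set)"
    by (intro semicircular_algebra.intros)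
  have "cyclic_derivative j (\<lambda>\<xi>. 0 *\<^sub>C id \<xi>) vacuum = (0 :: 'a fock)" for j
    unfolding cyclic_derivative_scale[OF semicircular_algebra.one] by (rule fock_eqI) simp
  then have "vacuum_tuple (cyclic_gradient (\<lambda>\<xi>. 0 *\<^sub>C id \<xi>)) = (0 :: 'a fock ^ 'a)"
    by (simp only: vec_eq_iff vacuum_tuple_def cyclic_gradient_def vec_lambda_beta zero_index) simp
  with * show "(0 :: 'a fock ^ 'a) \<in> gradient_space"
    unfolding gradient_space_def by (metis (mono_tags, lifting) mem_Collect_eq)
next
  fix u v :: "'a fock ^ 'a" assume "u \<in> gradient_space" "v \<in> gradient_space"
  then obtain a b where ab: "a \<in> semicircular_algebra" "b \<in> semicircular_algebra"
    "u = vacuum_tuple (cyclic_gradient a)" "v = vacuum_tuple (cyclic_gradient b)"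
    unfolding gradient_space_def by auto
  then have "u + v = vacuum_tuple (cyclic_gradient (\<lambda>\<xi>. a \<xi> + b \<xi>))"
    by (simp add: vec_eq_iff vacuum_tuple_def cyclic_gradient_def cyclic_derivative_add)
  with ab show "u + v \<in> gradient_space"
    unfolding gradient_space_def by (blast intro: semicircular_algebra.add)
next
  fix u :: "'a fock ^ 'a" and c assume "u \<in> gradient_space"
  then obtain a where a: "a \<in> semicircular_algebra" "u = vacuum_tuple (cyclic_gradient a)"
    unfolding gradient_space_def by auto
  then have "scaleC_tuple c u = vacuum_tuple (cyclic_gradient (\<lambda>\<xi>. c *\<^sub>C a \<xi>))"
    by (simp add: vec_eq_iff vacuum_tuple_def cyclic_gradient_def cyclic_derivative_scale
        scaleC_tuple_def)
  with a show "scaleC_tuple c u \<in> gradient_space"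
    unfolding gradient_space_def by (blast intro: semicircular_algebra.scale)
qed

text \<open>The gradient of \<open>monomial w\<close> minus \<open>cyclic_vector w\<close> is
  rotation invariant and lives on words shorter than \<open>w\<close>, so it is a combination of
  cyclic vectors already obtained.\<close>

lemma cyclic_vector_in_gradient_space: "cyclic_vector w \<in> gradient_space"
proof (induction w rule: measure_induct_rule[of length])
  case (less w)
  define g where "g = vacuum_tuple (cyclic_gradient (monomial w))"
  define u where "u = g - cyclic_vector w"
  \<comment> \<open>On words at least as long as \<open>w\<close> invariance is inherited from the
    gradient; on shorter words the vector vanishes.\<close>
  have "word_coeff (cyclic_vector w) (rotate1 x) = word_coeff (cyclic_vector w) x" for x
  proof (cases "length w \<le> length x")
    case True
    then show ?thesis
      using gradient_monomial_invariant[of w x]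
        word_coeff_gradient_monomial[of w x] word_coeff_gradient_monomial[of w "rotate1 x"] by simp
  next
    case False
    then have "rotate k w \<noteq> x" "rotate k w \<noteq> rotate1 x" for k
      by (metis length_rotate length_rotate1 order_refl)+
    then show ?thesis by (cases "x = []") (simp_all add: word_coeff_cyclic_vector)
  qed
  then have "u = (\<Sum>v | length v < length w.
      scaleC_tuple (word_coeff u v / of_nat (length v)) (cyclic_vector v))"
    by (intro cyclic_invariant_expansion)
      (simp_all add: u_def g_def word_coeff_diff gradient_monomial_invariant
        word_coeff_gradient_monomial)
  also have "\<dots> \<in> gradient_space"
    using less by (intro tuple.subspace_sum tuple.subspace_scale subspace_gradient_space) auto
  finally have "u \<in> gradient_space" .
  moreover have "g \<in> gradient_space"
    unfolding g_def gradient_space_def using monomial_in_algebra by blast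
  ultimately have "g - u \<in> gradient_space"
    by (intro tuple.subspace_diff subspace_gradient_space)
  then show ?case by (simp add: u_def)
qed

lemma gradient_space_eq_span:
  "gradient_space = tuple.span (range (cyclic_vector :: 'n::finite list \<Rightarrow> _))"
proof
  show "gradient_space \<subseteq> tuple.span (range (cyclic_vector :: 'n list \<Rightarrow> _))"
  proof
    fix u :: "'n fock ^ 'n" assume "u \<in> gradient_space"
    then obtain R where R: "R \<in> semicircular_algebra" "u = vacuum_tuple (cyclic_gradient R)"
      unfolding gradient_space_def by auto
    have "\<forall>j. u $ j \<in> finite_degree"
      by (auto simp: R(2) vacuum_tuple_def cyclic_gradient_def
          intro!: finite_degree_algebra cyclic_derivative_in_algebra R(1))
    then obtain N where N: "\<And>x. N \<le> length x \<Longrightarrow> word_coeff u x = 0"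
      unfolding finite_degree_tuple by blast
    have "word_coeff u (rotate1 x) = word_coeff u x" for x
      by (simp add: R(2) gradient_expansion[OF R(1)] word_coeff_sum word_coeff_scaleC
          gradient_monomial_invariant)
    from cyclic_invariant_expansion[OF this N]
    show "u \<in> tuple.span (range cyclic_vector)"
      by (metis (no_types, lifting) rangeI tuple.span_base tuple.span_scale tuple.span_sum)
  qed
  show "tuple.span (range (cyclic_vector :: 'n list \<Rightarrow> _)) \<subseteq> gradient_space"
    by (rule tuple.span_minimal[OF _ subspace_gradient_space])
      (auto intro: cyclic_vector_in_gradient_space)
qed

section \<open>Orthogonality in the space of tuples\<close>

lemma cinner_tuple_commute: "cinner_tuple v u = cnj (cinner_tuple u v)"
  unfolding cinner_tuple_def cnj_sum by (subst cinner_commute) (rule refl)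

lemma cinner_tuple_add_right: "cinner_tuple v (u + u') = cinner_tuple v u + cinner_tuple v u'"
  by (simp add: cinner_tuple_def cinner_add_right sum.distrib)

lemma cinner_tuple_scaleC_right: "cinner_tuple v (scaleC_tuple c u) = cnj c * cinner_tuple v u"
  by (simp add: cinner_tuple_def scaleC_tuple_def cinner_scaleC_right sum_distrib_left)

lemma subspace_orthogonal: "tuple.subspace {u. cinner_tuple v u = 0}"
  by (rule tuple.subspaceI)
    (auto simp: cinner_tuple_add_right cinner_tuple_scaleC_right, simp add: cinner_tuple_def)

text \<open>The real inner product sees only the real part of \<open>cinner_tuple\<close>; pairing
  with \<open>scaleC_tuple \<i> u\<close> recovers the imaginary part.\<close>

lemma closed_orthogonal: "closed {v :: 'a fock ^ 'm::finite. cinner_tuple v u = 0}"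
proof -
  have "cinner_tuple v u = 0 \<longleftrightarrow> inner v u = 0 \<and> inner v (scaleC_tuple \<i> u) = 0"
    for v :: "'a fock ^ 'm"
    by (simp add: inner_tuple cinner_tuple_scaleC_right complex_eq_iff)
  then have "{v :: 'a fock ^ 'm. cinner_tuple v u = 0} =
      {v. inner v u = 0} \<inter> {v. inner v (scaleC_tuple \<i> u) = 0}"
    by auto
  also have "closed \<dots>"
    by (intro closed_Int closed_Collect_eq continuous_intros)
  finally show ?thesis .
qed

lemma orth_complement_closure: "orth_complement (closure M) = orth_complement M"
  for M :: "('a fock ^ 'm::finite) set"
proof
  show "orth_complement M \<subseteq> orth_complement (closure M)"
  proof
    fix v assume "v \<in> orth_complement M"
    then have "M \<subseteq> {u. cinner_tuple u v = 0}"
      by (auto simp: orth_complement_def cinner_tuple_commute[of _ v])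
    then have "closure M \<subseteq> {u. cinner_tuple u v = 0}"
      by (intro closure_minimal closed_orthogonal)
    then show "v \<in> orth_complement (closure M)"
      by (auto simp: orth_complement_def cinner_tuple_commute[of v])
  qed
qed (use closure_subset[of M] in \<open>auto simp: orth_complement_def\<close>)

lemma orth_complement_gradient_space:
  "orth_complement gradient_space = {v. \<forall>w. cyclic_sum v w = 0}"
proof -
  have "gradient_space \<subseteq> {u. cinner_tuple v u = 0} \<longleftrightarrow>
      range cyclic_vector \<subseteq> {u. cinner_tuple v u = 0}" for v :: "'a fock ^ 'a"
    unfolding gradient_space_eq_span
  proof
    assume "tuple.span (range cyclic_vector) \<subseteq> {u. cinner_tuple v u = 0}"
    with tuple.span_superset show "range cyclic_vector \<subseteq> {u. cinner_tuple v u = 0}"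
      by (rule order_trans)
  qed (rule tuple.span_minimal[OF _ subspace_orthogonal])
  then show ?thesis
    by (simp add: orth_complement_def subset_iff Ball_def[symmetric] cinner_tuple_cyclic_vector)
qed

section \<open>The range of \<open>\<ell>\<^sub>j\<^sup>* - r\<^sub>j\<^sup>*\<close>\<close>

definition cyclic_difference :: "'n fock \<Rightarrow> 'n fock ^ 'n" where
  "cyclic_difference \<xi> = (\<chi> j. cadjoint (lcreate j) \<xi> - cadjoint (rcreate j) \<xi>)"

text \<open>Left annihilation reads the coefficient at \<open>j # w\<close>, right annihilation at
  \<open>w @ [j]\<close>, which is the former rotated by one letter.\<close>

lemma word_coeff_cyclic_difference:
  "x \<noteq> [] \<Longrightarrow> word_coeff (cyclic_difference \<xi>) x = coeff \<xi> x - coeff \<xi> (rotate1 x)"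
  by (cases x) (simp_all add: cyclic_difference_def cadjoint_lcreate cadjoint_rcreate)

lemma cyclic_sum_cyclic_difference: "cyclic_sum (cyclic_difference \<xi>) w = 0"
proof -
  have "cyclic_sum (cyclic_difference \<xi>) w =
      (\<Sum>k<length w. coeff \<xi> (rotate k w) - coeff \<xi> (rotate (Suc k) w))"
    unfolding cyclic_sum_def by (rule sum.cong) (auto intro!: word_coeff_cyclic_difference)
  then show ?thesis by (simp only: sum_subtractf sum_rotate_Suc[of "coeff \<xi>"]) simp
qed

text \<open>
  If \<open>V\<close> has vanishing sum along the rotations of \<open>w\<close>, then \<open>V = \<xi> - \<xi> \<circ> rotate1\<close> is solved by the
  weighted average \<open>\<xi> w = - (\<Sum>k<p. k V (rotate k w)) / p\<close> with \<open>p = length w\<close>.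
\<close>

lemma cyclic_difference_surj:
  fixes v :: "'n::finite fock ^ 'n"
  assumes zero: "\<And>w. cyclic_sum v w = 0" and deg: "\<And>j. v $ j \<in> finite_degree"
  shows "v \<in> cyclic_difference ` finite_degree"
proof -
  obtain N where N: "\<And>w. N \<le> length w \<Longrightarrow> word_coeff v w = 0"
    using deg finite_degree_tuple[of v] by blast
  define f where
    "f = (\<lambda>w. - (\<Sum>k<length w. of_nat k * word_coeff v (rotate k w)) / of_nat (length w))"
  define \<xi> where "\<xi> = (\<Sum>w | length w < N. f w *\<^sub>C basis w)"
  have f0: "f w = 0" if "N \<le> length w" for w
    using N that by (simp add: f_def)
  have \<xi>: "coeff \<xi> x = f x" for x
  proof -
    have "coeff \<xi> x = (\<Sum>w | length w < N. if w = x then f x else 0)"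
      unfolding \<xi>_def coeff_sum by (rule sum.cong) (auto simp: coeff_basis)
    then show ?thesis using f0[of x] by (auto simp: finite_words_less)
  qed
  have "\<xi> \<in> finite_degree"
    using f0 by (auto simp: finite_degree_def \<xi>)
  moreover have "v = cyclic_difference \<xi>"
  proof (rule word_coeff_eqI)
    fix x :: "'n list" assume "x \<noteq> []"
    define p where "p = length x"
    define V where "V k = word_coeff v (rotate k x)" for k
    have "p \<noteq> 0" "V p = V 0" using \<open>x \<noteq> []\<close> by (simp_all add: p_def V_def)
    \<comment> \<open>Summation by parts: telescoping \<open>k * V k\<close> isolates
      \<open>V 0\<close>, because the unweighted sum of \<open>V\<close> vanishes.\<close>
    have "(\<Sum>k<p. of_nat (Suc k) * V (Suc k) - of_nat k * V k) = of_nat p * V p"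
      by (subst sum_lessThan_telescope) simp
    moreover have "(\<Sum>k<p. V (Suc k)) = 0"
      using zero[of x] sum_rotate_Suc[of "word_coeff v" x] by (simp add: cyclic_sum_def V_def p_def)
    ultimately have "(\<Sum>k<p. of_nat k * V (Suc k)) - (\<Sum>k<p. of_nat k * V k) = of_nat p * V 0"
      by (simp add: distrib_right sum.distrib sum_subtractf \<open>V p = V 0\<close>)
    then have "f x - f (rotate1 x) = V 0"
      using \<open>p \<noteq> 0\<close> by (simp add: f_def p_def V_def rotate1_rotate_swap field_simps)
    then show "word_coeff v x = word_coeff (cyclic_difference \<xi>) x"
      by (simp add: word_coeff_cyclic_difference \<open>x \<noteq> []\<close> \<xi> V_def)
  qed
  ultimately show ?thesis by blast
qed

text \<open>Rotations preserve length, so truncation keeps or kills whole orbits; each truncation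
  has finite degree and hence lies in the range.\<close>

lemma cyclic_sum_zero_closure:
  fixes v :: "'n::finite fock ^ 'n"
  assumes "\<And>w. cyclic_sum v w = 0"
  shows "v \<in> closure (range cyclic_difference)"
  unfolding closure_sequential
proof (intro exI conjI allI)
  let ?t = "\<lambda>N. \<chi> j. truncate N (v $ j)"
  show "?t \<longlonglongrightarrow> v"
    by (rule vec_tendstoI) (simp add: truncate_tendsto)
  fix N
  \<comment> \<open>The cut-off concerns the components, whose words are one letter shorter than the
    encoding word; hence \<open>tl w\<close>.\<close>
  have "cyclic_sum (?t N) w = (if length (tl w) < N then cyclic_sum v w else 0)" for w
    by (simp add: cyclic_sum_def word_coeff_def coeff_truncate)
  then have "?t N \<in> cyclic_difference ` finite_degree"
    using assms by (intro cyclic_difference_surj)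
      (auto simp: finite_degree_def coeff_truncate intro!: exI[of _ N])
  then show "?t N \<in> range cyclic_difference" by blast
qed

lemma orth_complement_eq_closure:
  "orth_complement (closure gradient_space) =
     closure (range (cyclic_difference :: 'n::finite fock \<Rightarrow> _))" (is "_ = ?R")
proof
  show "orth_complement (closure gradient_space) \<subseteq> ?R"
    unfolding orth_complement_closure orth_complement_gradient_space
    using cyclic_sum_zero_closure by blast
  have "?R \<subseteq> {v. cinner_tuple v (cyclic_vector w) = 0}" for w
    by (intro closure_minimal closed_orthogonal)
      (auto simp: cinner_tuple_cyclic_vector cyclic_sum_cyclic_difference)
  then show "?R \<subseteq> orth_complement (closure gradient_space)"
    unfolding orth_complement_closure orth_complement_gradient_space
    by (auto simp: cinner_tuple_cyclic_vector)
qed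

section \<open>Divergence-free polynomial vector fields\<close>

text \<open>Reversing the tail of \<open>rotate k w\<close> while keeping its head gives a rotation
  of \<open>rev w\<close>, so the flip permutes the orbit up to conjugation and reversal.\<close>

lemma cyclic_sum_conj_flip:
  "cyclic_sum (\<chi> j. conj_flip (v $ j)) w = cnj (cyclic_sum v (rev w))"
proof -
  have "word_coeff (\<chi> j. conj_flip (v $ j)) (rotate k w) =
      cnj (word_coeff v (rotate (length w - Suc k) (rev w)))" if "k < length w" for k
  proof -
    have "rotate k w \<noteq> []" using that by auto
    then obtain i y where y: "rotate k w = i # y"
      by (meson neq_Nil_conv)
    \<comment> \<open>The rotation is identified after one more \<open>rotate1\<close>, which moves
      \<open>i\<close> to the end and produces a plain reversal; \<open>rotate1\<close> is
      injective.\<close>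
    have "rotate1 (rotate (length w - Suc k) (rev w)) = rotate (length w - k) (rev w)"
      using that by (simp only: rotate_Suc[symmetric] Suc_diff_Suc)
    also have "\<dots> = rev (i # y)"
      using that rotate_rev[of k "rev w"] unfolding y[symmetric] by simp
    also have "\<dots> = rotate1 (i # rev y)" by simp
    finally have "rotate (length w - Suc k) (rev w) = i # rev y"
      by (rule injD[OF inj_rotate1])
    then show ?thesis by (simp add: y)
  qed
  then have "cyclic_sum (\<chi> j. conj_flip (v $ j)) w =
      (\<Sum>k<length w. cnj (word_coeff v (rotate (length w - Suc k) (rev w))))"
    by (simp add: cyclic_sum_def)
  also have "\<dots> = (\<Sum>k<length w. cnj (word_coeff v (rotate k (rev w))))"
    by (rule sum.nat_diff_reindex)
  finally show ?thesis by (simp add: cyclic_sum_def)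
qed

text \<open>Moving \<open>P $ j\<close> across the inner product turns the trace condition into
  orthogonality of the flipped tuple to all gradients, that is, vanishing orbit sums.\<close>

lemma Vect_iff:
  "P \<in> Vect \<longleftrightarrow>
     (\<forall>j. P $ j \<in> semicircular_algebra) \<and> (\<forall>w. cyclic_sum (vacuum_tuple P) w = 0)"
proof -
  have "(\<forall>R\<in>semicircular_algebra. (\<Sum>j\<in>UNIV. vac_state (P $ j \<circ> cyclic_gradient R $ j)) = 0) \<longleftrightarrow>
      (\<forall>w. cyclic_sum (vacuum_tuple P) w = 0)" if P: "\<And>j. P $ j \<in> semicircular_algebra"
  proof -
    let ?v = "\<chi> j. conj_flip (vacuum_tuple P $ j)"
    have "(\<Sum>j\<in>UNIV. vac_state (P $ j \<circ> cyclic_gradient R $ j)) =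
        cinner_tuple (vacuum_tuple (cyclic_gradient R)) ?v" for R
      by (simp add: vac_state_def cinner_algebra_vacuum[OF P] cinner_tuple_def vacuum_tuple_def)
    then have "(\<forall>R\<in>semicircular_algebra.
        (\<Sum>j\<in>UNIV. vac_state (P $ j \<circ> cyclic_gradient R $ j)) = 0) \<longleftrightarrow>
        ?v \<in> orth_complement gradient_space"
      by (auto simp: orth_complement_def gradient_space_def cinner_tuple_commute[of ?v])
    also have "\<dots> \<longleftrightarrow> (\<forall>w. cyclic_sum (vacuum_tuple P) (rev w) = 0)"
      by (simp add: orth_complement_gradient_space cyclic_sum_conj_flip)
    also have "\<dots> \<longleftrightarrow> (\<forall>w. cyclic_sum (vacuum_tuple P) w = 0)"
      by (metis rev_rev_ident)
    finally show ?thesis .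
  qed
  then show ?thesis unfolding Vect_def by auto
qed

lemma vacuum_tuple_Vect:
  "vacuum_tuple ` Vect = cyclic_difference ` (finite_degree :: 'n::finite fock set)"
proof (intro equalityI subsetI)
  fix v :: "'n fock ^ 'n" assume "v \<in> vacuum_tuple ` Vect"
  then obtain P where "P \<in> Vect" "v = vacuum_tuple P" by blast
  then show "v \<in> cyclic_difference ` finite_degree"
    by (intro cyclic_difference_surj)
      (auto simp: Vect_iff, simp add: vacuum_tuple_def finite_degree_algebra)
next
  fix v :: "'n fock ^ 'n" assume "v \<in> cyclic_difference ` finite_degree"
  then obtain \<xi> where \<xi>: "\<xi> \<in> finite_degree" "v = cyclic_difference \<xi>" by blast
  then obtain N where "\<And>w. N \<le> length w \<Longrightarrow> coeff \<xi> w = 0" by (auto simp: finite_degree_def)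
  then have "v $ j \<in> finite_degree" for j
    by (auto simp: \<xi>(2) finite_degree_def cyclic_difference_def cadjoint_lcreate cadjoint_rcreate
        intro!: exI[of _ N])
  \<comment> \<open>Components of finite degree lift to polynomials, which gives the operator tuple
    \<open>P\<close>.\<close>
  then have "\<forall>j. \<exists>a\<in>semicircular_algebra. v $ j = a vacuum"
    by (auto simp flip: vacuum_image)
  then obtain P where P: "\<And>j. P j \<in> semicircular_algebra" "\<And>j. v $ j = P j vacuum" by metis
  then have v: "v = vacuum_tuple (\<chi> j. P j)" by (simp add: vec_eq_iff vacuum_tuple_def)
  then have "(\<chi> j. P j) \<in> Vect"
    using P(1) cyclic_sum_cyclic_difference[of \<xi>] \<xi>(2) by (simp add: Vect_iff)
  with v show "v \<in> vacuum_tuple ` Vect" by blast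
qed

section \<open>The homogeneous pieces of the range\<close>

lemma cyclic_difference_add:
  "cyclic_difference (\<xi> + \<eta>) = cyclic_difference \<xi> + cyclic_difference \<eta>"
  by (rule word_coeff_eqI) (simp add: word_coeff_cyclic_difference word_coeff_add)

lemma cyclic_difference_scaleC:
  "cyclic_difference (c *\<^sub>C \<xi>) = scaleC_tuple c (cyclic_difference \<xi>)"
  by (rule word_coeff_eqI)
    (simp add: word_coeff_cyclic_difference word_coeff_scaleC right_diff_distrib)

lemma cyclic_difference_zero: "cyclic_difference 0 = 0"
  by (rule word_coeff_eqI) (simp add: word_coeff_cyclic_difference word_coeff_zero)

lemma cyclic_difference_sum: "cyclic_difference (sum f A) = (\<Sum>x\<in>A. cyclic_difference (f x))"
  by (induction A rule: infinite_finite_induct)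
    (auto simp: cyclic_difference_add cyclic_difference_zero)

lemma cyclic_difference_basis: "w \<noteq> [] \<Longrightarrow> cyclic_difference (basis w) = X_generator w"
proof (rule word_coeff_eqI)
  fix x :: "'a list" assume w: "w \<noteq> []" and "x \<noteq> []"
  obtain i y where x: "x = i # y" using \<open>x \<noteq> []\<close> by (cases x) auto
  have "i # y = w \<longleftrightarrow> i = hd w \<and> y = tl w" "y @ [i] = w \<longleftrightarrow> i = last w \<and> y = butlast w"
    using w by auto
  then show "word_coeff (cyclic_difference (basis w)) x = word_coeff (X_generator w) x"
    unfolding word_coeff_cyclic_difference[OF \<open>x \<noteq> []\<close>]
    by (simp add: x coeff_basis X_generator_def)
qed

text \<open>Words of length at most one are fixed by rotation. This matches \<open>X_space 0\<close>
  being trivial.\<close>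

lemma cyclic_difference_basis_short: "length w \<le> 1 \<Longrightarrow> cyclic_difference (basis w) = 0"
proof (rule word_coeff_eqI)
  fix x :: "'a list" assume "length w \<le> 1"
  moreover have "x = w \<longleftrightarrow> rotate1 x = w" if "length w \<le> 1"
    using that by (cases x; cases w) auto
  moreover assume "x \<noteq> []"
  ultimately show "word_coeff (cyclic_difference (basis w)) x = word_coeff 0 x"
    by (simp add: word_coeff_cyclic_difference coeff_basis word_coeff_zero)
qed

lemma subspace_X_space: "tuple.subspace (X_space k)"
  by (simp add: X_space_def tuple.subspace_single_0)

text \<open>Truncated subtraction sends both the empty word and the single letters to
  \<open>X_space 0\<close>, where their images are 0.\<close>

lemma cyclic_difference_basis_X_space: "cyclic_difference (basis w) \<in> X_space (length w - 1)"
proof (cases "length w \<le> 1")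
  case True
  then show ?thesis
    by (simp add: cyclic_difference_basis_short tuple.subspace_0[OF subspace_X_space])
next
  case False
  then have "cyclic_difference (basis w) = X_generator w" "length w = Suc (length w - 1)"
    by (auto intro!: cyclic_difference_basis)
  with False show ?thesis
    unfolding X_space_def by (auto intro!: tuple.span_base)
qed

lemma subspace_cyclic_difference: "tuple.subspace (cyclic_difference ` finite_degree)"
proof (rule tuple.subspaceI)
  show "0 \<in> cyclic_difference ` finite_degree"
    using cyclic_difference_zero finite_degree_zero by (metis image_eqI)
qed (auto simp flip: cyclic_difference_add cyclic_difference_scaleC
    intro: finite_degree_add finite_degree_scaleC)

lemma X_space_subset: "X_space k \<subseteq> cyclic_difference ` finite_degree"
proof (cases "k = 0")
  case True
  then show ?thesis
    using tuple.subspace_0[OF subspace_cyclic_difference] by (simp add: X_space_def)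
next
  case False
  have "X_generator w \<in> cyclic_difference ` finite_degree" if "length w = Suc k" for w :: "'a list"
    using that cyclic_difference_basis[of w] finite_degree_basis[of w] by force
  then have "tuple.span {X_generator w | w :: 'a list. length w = Suc k} \<subseteq>
      cyclic_difference ` finite_degree"
    by (intro tuple.span_minimal subspace_cyclic_difference) auto
  with False show ?thesis by (simp add: X_space_def)
qed

lemma algebraic_sum_X_space:
  "algebraic_sum X_space = cyclic_difference ` (finite_degree :: 'n::finite fock set)"
proof (intro equalityI subsetI)
  fix v :: "'n fock ^ 'n" assume "v \<in> algebraic_sum X_space"
  then obtain F x where "v = (\<Sum>k\<in>F. x k)" "\<And>k. k \<in> F \<Longrightarrow> x k \<in> X_space k"
    by (auto simp: algebraic_sum_def)
  then show "v \<in> cyclic_difference ` finite_degree"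
    using X_space_subset by (auto intro!: tuple.subspace_sum[OF subspace_cyclic_difference])
next
  fix v :: "'n fock ^ 'n" assume "v \<in> cyclic_difference ` finite_degree"
  then obtain \<xi> where \<xi>: "\<xi> \<in> finite_degree" "v = cyclic_difference \<xi>" by blast
  then obtain N where N: "\<And>w. N \<le> length w \<Longrightarrow> coeff \<xi> w = 0" by (auto simp: finite_degree_def)
  let ?x = "\<lambda>w. scaleC_tuple (coeff \<xi> w) (cyclic_difference (basis w))"
  let ?S = "{w :: 'n list. length w < N}"
  have "v = (\<Sum>w\<in>?S. ?x w)"
    using arg_cong[OF basis_expansion[of N \<xi>, OF N], where f = cyclic_difference]
    by (simp only: \<xi>(2) cyclic_difference_sum cyclic_difference_scaleC)
  \<comment> \<open>Grouping by the degree \<open>length w - 1\<close> of the image puts each inner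
    sum into a single \<open>X_space k\<close>.\<close>
  also have "\<dots> = (\<Sum>k\<le>N. \<Sum>w | w \<in> ?S \<and> length w - 1 = k. ?x w)"
    by (rule sum.group[symmetric]) (auto simp: finite_words_less)
  finally have "v = (\<Sum>k\<le>N. \<Sum>w | w \<in> ?S \<and> length w - 1 = k. ?x w)" .
  moreover have "(\<Sum>w | w \<in> ?S \<and> length w - 1 = k. ?x w) \<in> X_space k" for k
    using cyclic_difference_basis_X_space
    by (intro tuple.subspace_sum[OF subspace_X_space] tuple.subspace_scale[OF subspace_X_space]) auto
  ultimately show "v \<in> algebraic_sum X_space"
    unfolding algebraic_sum_def by blast
qed

lemma X_space_homogeneous: "X_space k \<subseteq> {v. \<forall>j. v $ j \<in> homogeneous k}"
proof (cases "k = 0")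
  case False
  have "tuple.subspace {v. \<forall>j. v $ j \<in> homogeneous k}"
    by (rule tuple.subspaceI) (auto simp: homogeneous_def scaleC_tuple_def)
  then have "tuple.span {X_generator w | w. length w = Suc k} \<subseteq> {v. \<forall>j. v $ j \<in> homogeneous k}"
    by (rule tuple.span_minimal[rotated])
      (auto simp: X_generator_def homogeneous_def coeff_basis)
  with False show ?thesis by (simp add: X_space_def)
qed (simp add: X_space_def homogeneous_def)

theorem theorem7p5:
  shows "orth_complement
           (closure {vacuum_tuple (cyclic_gradient R) | R. R \<in> semicircular_algebra})
         = closure {\<chi> j. cadjoint (lcreate j) \<xi> - cadjoint (rcreate j) \<xi> | \<xi> :: 'n::finite fock. True}
       \<and> vacuum_tuple ` Vect = algebraic_sum (X_space :: nat \<Rightarrow> ('n fock ^ 'n) set)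
       \<and> (\<forall>k. X_space k \<subseteq> {v :: 'n fock ^ 'n. \<forall>j. v $ j \<in> homogeneous k})"
proof (intro conjI allI)
  show "orth_complement
      (closure {vacuum_tuple (cyclic_gradient R) | R. R \<in> semicircular_algebra})
    = closure {\<chi> j. cadjoint (lcreate j) \<xi> - cadjoint (rcreate j) \<xi> | \<xi> :: 'n fock. True}"
    using orth_complement_eq_closure
    by (simp add: gradient_space_def cyclic_difference_def full_SetCompr_eq)
qed (simp_all only: vacuum_tuple_Vect algebraic_sum_X_space X_space_homogeneous)

end
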